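(* Let $n\ge 1$, let $\{u_1,\dots,u_n\}\subset H^2$ be orthonormal and let $\{v_1,\dots,v_n\}\subset H^2$ be an orthogonal set of nonzero vectors. Suppose $g=\overline{\theta}$ on $\mathbb{T}$ with $\theta$ an inner function, and let $R_n:H^2\to H^2$ be given by $R_n h=T_{\overline{\theta}} h+\sum_{i=1}^n\langle h,u_i\rangle v_i$. Let $\Lambda\subset\{1,\dots,n\}$ be the set of all $k$ such that $\theta\nmid u_k$. Then the subspace $\ker R_n$ is nearly $S^*$-invariant with defect at most $n+|\Lambda|$ and defect space $F=\operatorname{span}\{\theta S^*v_i,\ P_{K_\theta}u_k : i\in\{1,\dots,n\},\ k\in\Lambda\}$.
   Context: $H^2$ is the Hardy space of the unit disc $\mathbb{D}$, identified via boundary values with a closed subspace of $L^2(\mathbb{T})$; $P:L^2(\mathbb{T})\to H^2$ is the orthogonal projection; for $g\in L^\infty(\mathbb{T})$ the Toeplitz operator is $T_g f=P(gf)$ for $f\in H^2$. The backward shift is $S^*f(z)=(f(z)-f(0))/z$. An inner function is a bounded analytic function on $\mathbb{D}$ with unimodular boundary values a.e. on $\mathbb{T}$. $K_\theta=H^2\ominus\theta H^2$ is the model space, $P_{K_\theta}$ the orthogonal projection onto it, and $\theta\nmid u_k$ means $u_k\notin\theta H^2$, i.e. $P_{K_\theta}u_k\ne 0$. $|\Lambda|$ is the number of elements of $\Lambda$. A subspace $M\subset H^2$ is nearly $S^*$-invariant with defect $m$ if there is an $m$-dimensional subspace $F$ such that $S^*f\in M+F$ whenever $f\in M$ and $f(0)=0$;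 $F$ is called the defect space. "Defect at most $d$ and defect space $F$" means that this inclusion holds with the given $F$ and $\dim F\le d$. *)

theory Defs
  imports "HOL-Complex_Analysis.Complex_Analysis" "HOL-Library.Function_Algebras"
begin

section \<open>The unit circle\<close>

text \<open>Normalised arc length, as a measure whose underlying space is the unit circle itself.\<close>

definition circle_measure :: "complex measure" where
  "circle_measure =
     distr (uniform_measure lborel {0..2 * pi}) (restrict_space borel (sphere 0 1)) cis"

text \<open>Elements of \<open>L\<^sup>2\<close> of the circle are represented by functions, not by classes modulo null
  sets; all notions below that involve them are insensitive to changes on null sets.\<close>

definition L2_circle :: "(complex \<Rightarrow> complex) set" where
  "L2_circle = {\<phi>. \<phi> \<in> borel_measurable circle_measure \<and>
                    integrable circle_measure (\<lambda>\<zeta>. (norm (\<phi> \<zeta>))\<^sup>2)}"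

definition L2_inner :: "(complex \<Rightarrow> complex) \<Rightarrow> (complex \<Rightarrow> complex) \<Rightarrow> complex" where
  "L2_inner \<phi> \<psi> = (LINT \<zeta>|circle_measure. \<phi> \<zeta> * cnj (\<psi> \<zeta>))"


section \<open>The complex vector space of functions\<close>

definition fun_scale :: "complex \<Rightarrow> (complex \<Rightarrow> complex) \<Rightarrow> complex \<Rightarrow> complex" where
  "fun_scale c f = (\<lambda>z. c * f z)"

interpretation cfun: vector_space fun_scale
  by unfold_locales (auto simp: fun_scale_def fun_eq_iff algebra_simps)


section \<open>The Hardy space of the unit disc\<close>

text \<open>A function on the disc is represented by its extension by \<open>0\<close> to the whole plane.
  Thereby equality in the Hardy space is equality of functions.\<close>

definition hardy2 :: "(complex \<Rightarrow> complex) set" where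
  "hardy2 = {f. f holomorphic_on ball 0 1 \<and> (\<forall>z. z \<notin> ball 0 1 \<longrightarrow> f z = 0) \<and>
       bdd_above ((\<lambda>r::real. LINT \<zeta>|circle_measure. (norm (f (of_real r * \<zeta>)))\<^sup>2) ` {0..<1})}"

text \<open>The boundary function of \<open>f\<close> in the Hardy space is the limit in \<open>L\<^sup>2\<close> of the dilates
  \<open>\<zeta> \<mapsto> f (r \<zeta>)\<close> as \<open>r\<close> increases to \<open>1\<close>. It is determined up to a null set, and equals the
  radial limit of \<open>f\<close> almost everywhere (Fatou).\<close>

definition has_boundary :: "(complex \<Rightarrow> complex) \<Rightarrow> (complex \<Rightarrow> complex) \<Rightarrow> bool" where
  "has_boundary f \<phi> \<longleftrightarrow> \<phi> \<in> L2_circle \<and>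
     ((\<lambda>r::real. LINT \<zeta>|circle_measure. (norm (f (of_real r * \<zeta>) - \<phi> \<zeta>))\<^sup>2) \<longlongrightarrow> 0) (at_left 1)"

definition boundary :: "(complex \<Rightarrow> complex) \<Rightarrow> complex \<Rightarrow> complex" where
  "boundary f = (SOME \<phi>. has_boundary f \<phi>)"

definition hardy_inner :: "(complex \<Rightarrow> complex) \<Rightarrow> (complex \<Rightarrow> complex) \<Rightarrow> complex" where
  "hardy_inner f g = L2_inner (boundary f) (boundary g)"

text \<open>The orthogonal projection of \<open>L\<^sup>2\<close> of the circle onto the Hardy space.\<close>

definition hardy_proj :: "(complex \<Rightarrow> complex) \<Rightarrow> complex \<Rightarrow> complex" where
  "hardy_proj \<phi> =
     (THE f. f \<in> hardy2 \<and> (\<forall>h\<in>hardy2. L2_inner (\<lambda>\<zeta>. \<phi> \<zeta> - boundary f \<zeta>) (boundary h) = 0))"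

definition toeplitz :: "(complex \<Rightarrow> complex) \<Rightarrow> (complex \<Rightarrow> complex) \<Rightarrow> complex \<Rightarrow> complex" where
  "toeplitz g f = hardy_proj (\<lambda>\<zeta>. g \<zeta> * boundary f \<zeta>)"

definition backward_shift :: "(complex \<Rightarrow> complex) \<Rightarrow> complex \<Rightarrow> complex" where
  "backward_shift f z =
     (if z \<notin> ball 0 1 then 0 else if z = 0 then deriv f 0 else (f z - f 0) / z)"


section \<open>Inner functions and model spaces\<close>

definition radial_limit :: "(complex \<Rightarrow> complex) \<Rightarrow> complex \<Rightarrow> complex" where
  "radial_limit f \<zeta> = Lim (at_left 1) (\<lambda>r::real. f (of_real r * \<zeta>))"

text \<open>Only the values of \<open>\<theta>\<close> on the open disc matter. The limit has to be required to exist, as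
  \<^const>\<open>Lim\<close> is total.\<close>

definition inner_function :: "(complex \<Rightarrow> complex) \<Rightarrow> bool" where
  "inner_function \<theta> \<longleftrightarrow> \<theta> holomorphic_on ball 0 1 \<and> bounded (\<theta> ` ball 0 1) \<and>
     (AE \<zeta> in circle_measure.
        ((\<lambda>r::real. \<theta> (of_real r * \<zeta>)) \<longlongrightarrow> radial_limit \<theta> \<zeta>) (at_left 1) \<and>
        norm (radial_limit \<theta> \<zeta>) = 1)"

definition inner_multiples :: "(complex \<Rightarrow> complex) \<Rightarrow> (complex \<Rightarrow> complex) set" where
  "inner_multiples \<theta> = (\<lambda>h. \<theta> * h) ` hardy2"

definition model_space :: "(complex \<Rightarrow> complex) \<Rightarrow> (complex \<Rightarrow> complex) set" where
  "model_space \<theta> = {f \<in> hardy2. \<forall>g\<in>inner_multiples \<theta>. hardy_inner f g = 0}"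

text \<open>The orthogonal projection of the Hardy space onto the model space.\<close>

definition model_proj :: "(complex \<Rightarrow> complex) \<Rightarrow> (complex \<Rightarrow> complex) \<Rightarrow> complex \<Rightarrow> complex" where
  "model_proj \<theta> f =
     (THE g. g \<in> model_space \<theta> \<and> (\<forall>k\<in>model_space \<theta>. hardy_inner (f - g) k = 0))"


section \<open>Near invariance with finite defect\<close>

text \<open>\<open>M\<close> is a nearly invariant subspace for the backward shift with defect at most \<open>d\<close> and defect
  space \<open>F\<close>. Finite-dimensionality is a separate clause, since \<open>cfun.dim\<close> is \<open>0\<close> on
  infinite-dimensional spaces.\<close>

definition nearly_invariant ::
    "(complex \<Rightarrow> complex) set \<Rightarrow> nat \<Rightarrow> (complex \<Rightarrow> complex) set \<Rightarrow> bool" where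
  "nearly_invariant M d F \<longleftrightarrow>
     M \<subseteq> hardy2 \<and> cfun.subspace M \<and>
     F \<subseteq> hardy2 \<and> cfun.subspace F \<and> (\<exists>B. finite B \<and> F = cfun.span B) \<and> cfun.dim F \<le> d \<and>
     (\<forall>f\<in>M. f 0 = 0 \<longrightarrow> (\<exists>g\<in>M. \<exists>h\<in>F. backward_shift f = g + h))"

end

theory Submission imports Defs
begin

text \<open>Write \<open>T\<close> for the Toeplitz operator whose symbol is the conjugate of \<open>\<theta>\<close>, and \<open>S\<^sup>*\<close> for the backward
  shift. On the Hardy space, \<open>T\<close> is the adjoint of multiplication by \<open>\<theta>\<close>, which is an isometry. Hence
  \<open>T (\<theta> f) = f\<close>, the kernel of \<open>T\<close> is the model space, and \<open>T\<close> commutes with \<open>S\<^sup>*\<close>, because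
  multiplication by \<open>\<theta>\<close> commutes with multiplication by \<open>z\<close>.

  Let \<open>R h = 0\<close>. Applying \<open>S\<^sup>*\<close> gives \<open>T (S\<^sup>* h) + (\<Sum>i. \<langle>h, u\<^sub>i\<rangle> S\<^sup>* v\<^sub>i) = 0\<close>, that is, \<open>T f = 0\<close> for
  \<open>f = S\<^sup>* h + (\<Sum>i. \<langle>h, u\<^sub>i\<rangle> \<theta> S\<^sup>* v\<^sub>i)\<close>. So \<open>f\<close> lies in the model space. Let \<open>p\<close> be its projection onto the
  span of the projections of the \<open>u\<^sub>k\<close>, \<open>k \<in> \<Lambda>\<close>, to the model space. Then \<open>f - p\<close> is in the model space and
  is orthogonal to every \<open>u\<^sub>k\<close>: for \<open>k \<in> \<Lambda>\<close> by the choice of \<open>p\<close>, and for the other \<open>k\<close> because \<open>u\<^sub>k\<close> is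
  then a multiple of \<open>\<theta>\<close>. Therefore \<open>R (f - p) = 0\<close>, and \<open>S\<^sup>* h\<close> differs from \<open>f - p\<close> by an element of
  the span in question, whose generators number at most \<open>n + \<bar>\<Lambda>\<bar>\<close>.

  Most of the work is the Hardy space itself. Parseval's identity on circles of radius \<open>r < 1\<close> identifies
  it with the square-summable Taylor coefficients (\<open>hardy2_iff\<close>). Together with completeness of \<open>L\<^sup>2\<close>
  (\<open>L2_complete\<close>) this yields boundary functions (\<open>boundary_exists\<close>), the inner product as a coefficient sum
  (\<open>hardy_inner_sums\<close>), and the projection from \<open>L\<^sup>2\<close> (\<open>hardy_proj\<close>). The adjoint relation is
  \<open>toeplitz_adjoint\<close>; it also gives the projection onto the model space explicitly, as \<open>f - \<theta> T f\<close>
  (\<open>model_proj\<close>). The projection onto a span of finitely many vectors is Gram--Schmidt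
  (\<open>finite_orthogonal_projection\<close>), so no abstract projection theorem is used.\<close>

section \<open>Square-integrable functions on the circle\<close>

lemma space_circle_measure: "space circle_measure = sphere 0 1"
  by (simp add: circle_measure_def space_restrict_space)

lemma sets_circle_measure: "sets circle_measure = sets (restrict_space borel (sphere 0 1))"
  by (simp add: circle_measure_def)

lemma cis_measurable: "cis \<in> measurable (uniform_measure lborel {0..2 * pi}) (restrict_space borel (sphere 0 1))"
proof (rule measurable_restrict_space2)
  have "cis \<in> borel_measurable borel"
    by (intro borel_measurable_continuous_onI continuous_intros)
  then show "cis \<in> borel_measurable (uniform_measure lborel {0..2 * pi})"
    by measurable
qed auto

lemma borel_measurable_circle:
  assumes "continuous_on (sphere 0 1) f"
  shows "f \<in> borel_measurable circle_measure"
  using borel_measurable_continuous_on_restrict[OF assms]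
  by (simp add: measurable_cong_sets[OF sets_circle_measure refl])

lemma emeasure_circle_measure: "emeasure circle_measure (space circle_measure) = 1"
proof -
  have "emeasure circle_measure (space circle_measure) =
      emeasure (uniform_measure lborel {0..2*pi}) (cis -` sphere 0 1)"
    using emeasure_distr[OF cis_measurable sets.top]
    unfolding circle_measure_def by (simp add: space_restrict_space)
  also have "cis -` sphere 0 1 = UNIV" by auto
  also have "emeasure (uniform_measure lborel {0..2*pi}) UNIV = ennreal (2*pi) / ennreal (2*pi)"
    using emeasure_uniform_measure[of "{0..2*pi}" lborel UNIV] by simp
  also have "\<dots> = 1"
    by (rule ennreal_divide_self) simp_all
  finally show ?thesis .
qed

interpretation circle: finite_measure circle_measure
  by (rule finite_measureI) (simp only: emeasure_circle_measure, simp)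

lemma measure_circle_measure: "measure circle_measure (space circle_measure) = 1"
  by (simp add: measure_def emeasure_circle_measure)

lemma integral_circle_measure:
  fixes f :: "complex \<Rightarrow> complex"
  assumes "f \<in> borel_measurable circle_measure"
  shows "integral\<^sup>L circle_measure f = (LINT t|lborel. (indicator {0..2*pi} t / (2*pi)) *\<^sub>R f (cis t))"
proof -
  have f: "f \<in> borel_measurable (restrict_space borel (sphere 0 1))"
    using assms by (simp add: measurable_cong_sets[OF sets_circle_measure refl])
  have u: "uniform_measure lborel {0..2*pi} = density lborel (\<lambda>t. ennreal (indicator {0..2*pi} t / (2*pi)))"
    unfolding uniform_measure_def
  proof (rule density_cong)
    have "1 / ennreal (2*pi) = ennreal (1 / (2*pi))"
      using divide_ennreal[of 1 "2*pi"] by simp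
    then show "AE t in lborel. indicator {0..2*pi} t / emeasure lborel {0..2*pi} = ennreal (indicator {0..2*pi} t / (2*pi))"
      by (intro AE_I2) (simp add: indicator_def del: divide_ennreal)
  qed auto
  have "integral\<^sup>L circle_measure f = integral\<^sup>L (uniform_measure lborel {0..2*pi}) (\<lambda>t. f (cis t))"
    unfolding circle_measure_def by (rule integral_distr[OF cis_measurable f])
  also have "\<dots> = (LINT t|lborel. (indicator {0..2*pi} t / (2*pi)) *\<^sub>R f (cis t))"
    unfolding u
  proof (rule integral_density)
    show "(\<lambda>t. f (cis t)) \<in> borel_measurable lborel"
      using measurable_compose[OF cis_measurable f] by measurable
  qed auto
  finally show ?thesis .
qed

text \<open>Orthonormality of the monomials: for \<open>k \<noteq> m\<close> the integrand \<open>cis ((k - m) t)\<close> has the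
  \<open>2\<pi>\<close>-periodic primitive \<open>cis ((k - m) t) / (\<i> (k - m))\<close>.\<close>

lemma integral_circle_monomials:
  "(LINT \<zeta>|circle_measure. \<zeta> ^ k * cnj (\<zeta> ^ m)) = (if k = m then 1 else 0)"
proof (cases "k = m")
  case True
  have "(LINT \<zeta>|circle_measure. \<zeta> ^ k * cnj (\<zeta> ^ m)) = (LINT \<zeta>|circle_measure. 1)"
    using True
    by (intro Bochner_Integration.integral_cong)
       (auto simp: space_circle_measure norm_power simp flip: complex_norm_square power_mult_distrib)
  then show ?thesis using True by (simp add: measure_circle_measure)
next
  case False
  define a where "a = real k - real m"
  have a: "a \<noteq> 0" using False by (simp add: a_def)
  define F where "F = (\<lambda>t. cis (a * t) / (\<i> * of_real a))"
  have "(LINT \<zeta>|circle_measure. \<zeta> ^ k * cnj (\<zeta> ^ m)) =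
     (LINT t|lborel. (indicator {0..2*pi} t / (2*pi)) *\<^sub>R (cis t ^ k * cnj (cis t ^ m)))"
    by (rule integral_circle_measure) (intro borel_measurable_circle continuous_intros)
  also have "\<dots> = (LINT t|lborel. (1/(2*pi)) *\<^sub>R (indicator {0..2*pi} t *\<^sub>R cis (a * t)))"
    by (intro Bochner_Integration.integral_cong)
       (auto simp: Complex.DeMoivre cis_cnj cis_mult a_def algebra_simps)
  also have "\<dots> = (1/(2*pi)) *\<^sub>R (LINT t|lborel. indicator {0..2*pi} t *\<^sub>R cis (a * t))"
    by (rule integral_scaleR_right)
  also have "(LINT t|lborel. indicator {0..2*pi} t *\<^sub>R cis (a * t)) = F (2*pi) - F 0"
  proof (rule integral_FTC_Icc)
    show "(F has_vector_derivative cis (a * t)) (at t within {0..2*pi})" for t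
      unfolding F_def cis_conv_exp
      unfolding of_real_mult
      by (rule has_vector_derivative_real_field) (use a in \<open>auto intro!: derivative_eq_intros simp: complex_eq_iff\<close>)
  qed (auto intro!: continuous_intros)
  also have "F (2*pi) - F 0 = 0"
  proof -
    have "cis (a * (2*pi)) = 1"
    proof -
      have "a * (2*pi) = 2 * pi * of_int (int k - int m)" by (simp add: a_def)
      then show ?thesis using cis_multiple_2pi[of "of_int (int k - int m)"] by (metis Ints_of_int)
    qed
    then show ?thesis by (simp add: F_def)
  qed
  finally show ?thesis using False by simp
qed

text \<open>Only squares of \<open>L\<^sup>2\<close> norms occur below. For them \<open>\<bar>a + b\<bar>\<^sup>2 \<le> 2 \<bar>a\<bar>\<^sup>2 + 2 \<bar>b\<bar>\<^sup>2\<close> replaces the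
  triangle inequality; the factor 2 does no harm in limit arguments.\<close>

definition L2_sq :: "(complex \<Rightarrow> complex) \<Rightarrow> real" where
  "L2_sq \<phi> = (LINT \<zeta>|circle_measure. (norm (\<phi> \<zeta>))\<^sup>2)"

lemma L2_measurable [measurable_dest]: "\<phi> \<in> L2_circle \<Longrightarrow> \<phi> \<in> borel_measurable circle_measure"
  by (simp add: L2_circle_def)

lemma L2_integrable: "\<phi> \<in> L2_circle \<Longrightarrow> integrable circle_measure (\<lambda>\<zeta>. (norm (\<phi> \<zeta>))\<^sup>2)"
  by (simp add: L2_circle_def)

lemma L2_sq_nonneg [simp]: "L2_sq \<phi> \<ge> 0"
  by (simp add: L2_sq_def)

lemma L2_bounded:
  assumes "\<phi> \<in> borel_measurable circle_measure" "\<And>\<zeta>. norm \<zeta> = 1 \<Longrightarrow> norm (\<phi> \<zeta>) \<le> B"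
  shows "\<phi> \<in> L2_circle"
proof -
  have "integrable circle_measure (\<lambda>\<zeta>. (norm (\<phi> \<zeta>))\<^sup>2)"
  proof (rule circle.integrable_const_bound[where B="B\<^sup>2"])
    show "AE x in circle_measure. norm ((cmod (\<phi> x))\<^sup>2) \<le> B\<^sup>2"
      using assms(2) by (intro AE_I2) (auto simp: space_circle_measure intro!: power_mono)
    show "(\<lambda>x. (cmod (\<phi> x))\<^sup>2) \<in> borel_measurable circle_measure" using assms(1) by measurable
  qed
  with assms(1) show ?thesis by (simp add: L2_circle_def)
qed

lemma L2_continuous:
  assumes "continuous_on (sphere 0 1) \<phi>"
  shows "\<phi> \<in> L2_circle"
proof -
  have "bounded (\<phi> ` sphere 0 1)"
    by (intro compact_imp_bounded compact_continuous_image assms) auto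
  then obtain B where "\<forall>\<zeta>\<in>sphere 0 1. norm (\<phi> \<zeta>) \<le> B"
    by (auto simp: bounded_iff)
  then show ?thesis using borel_measurable_circle[OF assms] by (intro L2_bounded[of _ B]) auto
qed

lemma norm_add_sq_le: "(norm (a + b :: complex))\<^sup>2 \<le> 2 * (norm a)\<^sup>2 + 2 * (norm b)\<^sup>2"
proof -
  have "(norm (a + b))\<^sup>2 \<le> (norm a + norm b)\<^sup>2"
    by (intro power_mono norm_triangle_ineq) auto
  also have "\<dots> \<le> 2 * (norm a)\<^sup>2 + 2 * (norm b)\<^sup>2"
    using zero_le_power2[of "norm a - norm b"] by (simp add: power2_eq_square algebra_simps)
  finally show ?thesis .
qed

lemma L2_add:
  assumes "\<phi> \<in> L2_circle" "\<psi> \<in> L2_circle"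
  shows "(\<lambda>\<zeta>. \<phi> \<zeta> + \<psi> \<zeta>) \<in> L2_circle"
    and "L2_sq (\<lambda>\<zeta>. \<phi> \<zeta> + \<psi> \<zeta>) \<le> 2 * L2_sq \<phi> + 2 * L2_sq \<psi>"
proof -
  note [measurable] = assms[THEN L2_measurable] and [simp] = assms[THEN L2_integrable]
  have int: "integrable circle_measure (\<lambda>\<zeta>. 2 * (norm (\<phi> \<zeta>))\<^sup>2 + 2 * (norm (\<psi> \<zeta>))\<^sup>2)"
    by simp
  have "integrable circle_measure (\<lambda>\<zeta>. (norm (\<phi> \<zeta> + \<psi> \<zeta>))\<^sup>2)"
    by (rule Bochner_Integration.integrable_bound[OF int]) (use norm_add_sq_le in \<open>auto intro!: AE_I2\<close>)
  then show "(\<lambda>\<zeta>. \<phi> \<zeta> + \<psi> \<zeta>) \<in> L2_circle" by (simp add: L2_circle_def)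
  have "L2_sq (\<lambda>\<zeta>. \<phi> \<zeta> + \<psi> \<zeta>) \<le> (LINT \<zeta>|circle_measure. 2 * (norm (\<phi> \<zeta>))\<^sup>2 + 2 * (norm (\<psi> \<zeta>))\<^sup>2)"
    unfolding L2_sq_def
    by (intro integral_mono int norm_add_sq_le) fact
  then show "L2_sq (\<lambda>\<zeta>. \<phi> \<zeta> + \<psi> \<zeta>) \<le> 2 * L2_sq \<phi> + 2 * L2_sq \<psi>"
    by (simp add: L2_sq_def)
qed

lemma L2_mult_bounded:
  assumes "m \<in> borel_measurable circle_measure" "AE \<zeta> in circle_measure. norm (m \<zeta>) \<le> B"
    and "\<phi> \<in> L2_circle"
  shows "(\<lambda>\<zeta>. m \<zeta> * \<phi> \<zeta>) \<in> L2_circle" and "L2_sq (\<lambda>\<zeta>. m \<zeta> * \<phi> \<zeta>) \<le> B\<^sup>2 * L2_sq \<phi>"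
proof -
  note [measurable] = assms(1) assms(3)[THEN L2_measurable]
  note [simp] = assms(3)[THEN L2_integrable]
  have int: "integrable circle_measure (\<lambda>\<zeta>. B\<^sup>2 * (norm (\<phi> \<zeta>))\<^sup>2)"
    by simp
  have le: "AE \<zeta> in circle_measure. (norm (m \<zeta> * \<phi> \<zeta>))\<^sup>2 \<le> B\<^sup>2 * (norm (\<phi> \<zeta>))\<^sup>2"
    using assms(2) by eventually_elim (auto simp: norm_mult power_mult_distrib intro!: mult_right_mono power_mono)
  have i: "integrable circle_measure (\<lambda>\<zeta>. (norm (m \<zeta> * \<phi> \<zeta>))\<^sup>2)"
    by (rule Bochner_Integration.integrable_bound[OF int]) (use le in auto)
  then show "(\<lambda>\<zeta>. m \<zeta> * \<phi> \<zeta>) \<in> L2_circle" by (simp add: L2_circle_def)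
  have "L2_sq (\<lambda>\<zeta>. m \<zeta> * \<phi> \<zeta>) \<le> (LINT \<zeta>|circle_measure. B\<^sup>2 * (norm (\<phi> \<zeta>))\<^sup>2)"
    unfolding L2_sq_def by (intro integral_mono_AE int i le)
  then show "L2_sq (\<lambda>\<zeta>. m \<zeta> * \<phi> \<zeta>) \<le> B\<^sup>2 * L2_sq \<phi>"
    by (simp add: L2_sq_def)
qed

lemma L2_scale: "\<phi> \<in> L2_circle \<Longrightarrow> (\<lambda>\<zeta>. c * \<phi> \<zeta>) \<in> L2_circle"
  by (rule L2_mult_bounded(1)[where B="norm c"]) auto

lemma L2_diff:
  assumes "\<phi> \<in> L2_circle" "\<psi> \<in> L2_circle"
  shows "(\<lambda>\<zeta>. \<phi> \<zeta> - \<psi> \<zeta>) \<in> L2_circle"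
  using L2_add(1)[OF assms(1) L2_scale[OF assms(2), of "-1"]] by simp

lemma L2_sq_minus_commute: "L2_sq (\<lambda>\<zeta>. \<phi> \<zeta> - \<psi> \<zeta>) = L2_sq (\<lambda>\<zeta>. \<psi> \<zeta> - \<phi> \<zeta>)"
  by (simp add: L2_sq_def norm_minus_commute)

lemma L2_sq_triangle:
  assumes "\<phi> \<in> L2_circle" "\<psi> \<in> L2_circle" "\<eta> \<in> L2_circle"
  shows "L2_sq (\<lambda>\<zeta>. \<phi> \<zeta> - \<eta> \<zeta>) \<le> 2 * L2_sq (\<lambda>\<zeta>. \<phi> \<zeta> - \<psi> \<zeta>) + 2 * L2_sq (\<lambda>\<zeta>. \<eta> \<zeta> - \<psi> \<zeta>)"
  using L2_add(2)[OF L2_diff[OF assms(1,2)] L2_diff[OF assms(2,3)]]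
  by (simp add: L2_sq_minus_commute[of \<psi> \<eta>])

lemma borel_measurable_cnj [measurable (raw)]:
  "f \<in> borel_measurable M \<Longrightarrow> (\<lambda>x. cnj (f x)) \<in> borel_measurable M"
  by (rule borel_measurable_continuous_on[where f=cnj]) (intro continuous_intros)

lemma L2_Cauchy_Schwarz:
  assumes "\<phi> \<in> L2_circle" "\<psi> \<in> L2_circle"
  shows "integrable circle_measure (\<lambda>\<zeta>. \<phi> \<zeta> * cnj (\<psi> \<zeta>))"
    and "(LINT \<zeta>|circle_measure. norm (\<phi> \<zeta>) * norm (\<psi> \<zeta>))\<^sup>2 \<le> L2_sq \<phi> * L2_sq \<psi>"
    and "(norm (L2_inner \<phi> \<psi>))\<^sup>2 \<le> L2_sq \<phi> * L2_sq \<psi>"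
proof -
  note [measurable] = assms[THEN L2_measurable] and [simp] = assms[THEN L2_integrable]
  have int: "integrable circle_measure (\<lambda>\<zeta>. (norm (\<phi> \<zeta>))\<^sup>2 + (norm (\<psi> \<zeta>))\<^sup>2)" by simp
  have le: "norm (\<phi> \<zeta>) * norm (\<psi> \<zeta>) \<le> (norm (\<phi> \<zeta>))\<^sup>2 + (norm (\<psi> \<zeta>))\<^sup>2" for \<zeta>
  proof -
    have "0 \<le> norm (\<phi> \<zeta>) * norm (\<psi> \<zeta>)" by simp
    then show ?thesis using sum_squares_bound[of "norm (\<phi> \<zeta>)" "norm (\<psi> \<zeta>)"] by linarith
  qed
  show i: "integrable circle_measure (\<lambda>\<zeta>. \<phi> \<zeta> * cnj (\<psi> \<zeta>))"
    by (rule Bochner_Integration.integrable_bound[OF int]) (auto simp: norm_mult le)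
  have i': "integrable circle_measure (\<lambda>\<zeta>. norm (\<phi> \<zeta>) * norm (\<psi> \<zeta>))"
    using integrable_norm[OF i] by (simp add: norm_mult)
  have "(\<integral>\<^sup>+\<zeta>. ennreal (norm (\<phi> \<zeta>)) * ennreal (norm (\<psi> \<zeta>)) \<partial>circle_measure)\<^sup>2
      \<le> (\<integral>\<^sup>+\<zeta>. (ennreal (norm (\<phi> \<zeta>)))\<^sup>2 \<partial>circle_measure) * (\<integral>\<^sup>+\<zeta>. (ennreal (norm (\<psi> \<zeta>)))\<^sup>2 \<partial>circle_measure)"
    by (rule Cauchy_Schwarz_nn_integral) auto
  moreover have "(\<integral>\<^sup>+\<zeta>. ennreal (norm (\<phi> \<zeta>)) * ennreal (norm (\<psi> \<zeta>)) \<partial>circle_measure)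
      = ennreal (LINT \<zeta>|circle_measure. norm (\<phi> \<zeta>) * norm (\<psi> \<zeta>))"
    using nn_integral_eq_integral[OF i'] by (simp add: ennreal_mult)
  moreover have "(\<integral>\<^sup>+\<zeta>. (ennreal (norm (\<phi> \<zeta>)))\<^sup>2 \<partial>circle_measure) = ennreal (L2_sq \<phi>)"
    using nn_integral_eq_integral[OF L2_integrable[OF assms(1)]] by (simp add: ennreal_power L2_sq_def)
  moreover have "(\<integral>\<^sup>+\<zeta>. (ennreal (norm (\<psi> \<zeta>)))\<^sup>2 \<partial>circle_measure) = ennreal (L2_sq \<psi>)"
    using nn_integral_eq_integral[OF L2_integrable[OF assms(2)]] by (simp add: ennreal_power L2_sq_def)
  ultimately show cs: "(LINT \<zeta>|circle_measure. norm (\<phi> \<zeta>) * norm (\<psi> \<zeta>))\<^sup>2 \<le> L2_sq \<phi> * L2_sq \<psi>"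
    by (simp add: ennreal_power ennreal_mult[symmetric])
  have "norm (L2_inner \<phi> \<psi>) \<le> (LINT \<zeta>|circle_measure. norm (\<phi> \<zeta>) * norm (\<psi> \<zeta>))"
    unfolding L2_inner_def using integral_norm_bound[of circle_measure "\<lambda>\<zeta>. \<phi> \<zeta> * cnj (\<psi> \<zeta>)"]
    by (simp add: norm_mult)
  then have "(norm (L2_inner \<phi> \<psi>))\<^sup>2 \<le> (LINT \<zeta>|circle_measure. norm (\<phi> \<zeta>) * norm (\<psi> \<zeta>))\<^sup>2"
    by (intro power_mono) auto
  with cs show "(norm (L2_inner \<phi> \<psi>))\<^sup>2 \<le> L2_sq \<phi> * L2_sq \<psi>" by linarith
qed

lemma L2_inner_add_left:
  assumes "\<phi> \<in> L2_circle" "\<psi> \<in> L2_circle" "\<eta> \<in> L2_circle"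
  shows "L2_inner (\<lambda>\<zeta>. \<phi> \<zeta> + \<psi> \<zeta>) \<eta> = L2_inner \<phi> \<eta> + L2_inner \<psi> \<eta>"
  using L2_Cauchy_Schwarz(1)[OF assms(1,3)] L2_Cauchy_Schwarz(1)[OF assms(2,3)]
  by (simp add: L2_inner_def distrib_right)

lemma L2_inner_diff_left:
  assumes "\<phi> \<in> L2_circle" "\<psi> \<in> L2_circle" "\<eta> \<in> L2_circle"
  shows "L2_inner (\<lambda>\<zeta>. \<phi> \<zeta> - \<psi> \<zeta>) \<eta> = L2_inner \<phi> \<eta> - L2_inner \<psi> \<eta>"
  using L2_Cauchy_Schwarz(1)[OF assms(1,3)] L2_Cauchy_Schwarz(1)[OF assms(2,3)]
  by (simp add: L2_inner_def left_diff_distrib)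

lemma L2_inner_scale_left: "L2_inner (\<lambda>\<zeta>. c * \<phi> \<zeta>) \<eta> = c * L2_inner \<phi> \<eta>"
  by (simp add: L2_inner_def mult.assoc)

lemma L2_inner_commute: "L2_inner \<psi> \<phi> = cnj (L2_inner \<phi> \<psi>)"
proof -
  have "cnj (L2_inner \<phi> \<psi>) = (LINT \<zeta>|circle_measure. cnj (\<phi> \<zeta> * cnj (\<psi> \<zeta>)))"
    unfolding L2_inner_def by (rule Bochner_Integration.integral_cnj[symmetric])
  then show ?thesis by (simp add: L2_inner_def mult.commute)
qed

lemma L2_inner_diff_right:
  assumes "\<phi> \<in> L2_circle" "\<psi> \<in> L2_circle" "\<eta> \<in> L2_circle"
  shows "L2_inner \<eta> (\<lambda>\<zeta>. \<phi> \<zeta> - \<psi> \<zeta>) = L2_inner \<eta> \<phi> - L2_inner \<eta> \<psi>"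
  using L2_inner_diff_left[OF assms] L2_inner_commute by (metis complex_cnj_diff)

lemma L2_inner_self: "L2_inner \<phi> \<phi> = of_real (L2_sq \<phi>)"
  unfolding L2_inner_def L2_sq_def complex_norm_square[symmetric] by (rule integral_complex_of_real)

lemma L2_inner_tendsto:
  assumes "\<forall>\<^sub>F r in F. \<phi> r \<in> L2_circle" "\<psi> \<in> L2_circle" "\<eta> \<in> L2_circle"
    and lim: "((\<lambda>r. L2_sq (\<lambda>\<zeta>. \<phi> r \<zeta> - \<psi> \<zeta>)) \<longlongrightarrow> 0) F"
  shows "((\<lambda>r. L2_inner (\<phi> r) \<eta>) \<longlongrightarrow> L2_inner \<psi> \<eta>) F"
proof (rule Lim_transform)
  have "((\<lambda>r. sqrt (L2_sq (\<lambda>\<zeta>. \<phi> r \<zeta> - \<psi> \<zeta>) * L2_sq \<eta>)) \<longlongrightarrow> sqrt (0 * L2_sq \<eta>)) F"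
    by (intro tendsto_intros lim)
  then have *: "((\<lambda>r. sqrt (L2_sq (\<lambda>\<zeta>. \<phi> r \<zeta> - \<psi> \<zeta>) * L2_sq \<eta>)) \<longlongrightarrow> 0) F" by simp
  show "((\<lambda>r. L2_inner (\<phi> r) \<eta> - L2_inner \<psi> \<eta>) \<longlongrightarrow> 0) F"
  proof (rule Lim_null_comparison[OF _ *])
    show "\<forall>\<^sub>F r in F. norm (L2_inner (\<phi> r) \<eta> - L2_inner \<psi> \<eta>) \<le> sqrt (L2_sq (\<lambda>\<zeta>. \<phi> r \<zeta> - \<psi> \<zeta>) * L2_sq \<eta>)"
      using assms(1)
    proof eventually_elim
      case (elim r)
      have "(norm (L2_inner (\<phi> r) \<eta> - L2_inner \<psi> \<eta>))\<^sup>2 = (norm (L2_inner (\<lambda>\<zeta>. \<phi> r \<zeta> - \<psi> \<zeta>) \<eta>))\<^sup>2"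
        by (simp add: L2_inner_diff_left elim assms)
      also have "\<dots> \<le> L2_sq (\<lambda>\<zeta>. \<phi> r \<zeta> - \<psi> \<zeta>) * L2_sq \<eta>"
        by (intro L2_Cauchy_Schwarz(3) L2_diff elim assms)
      finally show ?case by (rule real_le_rsqrt)
    qed
  qed
qed simp

text \<open>Riesz--Fischer. As the measure is finite, the sequence is also Cauchy in \<open>L\<^sup>1\<close>, so a subsequence
  converges almost everywhere; Fatou's lemma along this subsequence bounds the \<open>L\<^sup>2\<close> distance of each
  \<open>s n\<close> to the pointwise limit.\<close>

lemma L2_complete:
  assumes s: "\<And>n. s n \<in> L2_circle"
    and cauchy: "\<And>e. e > 0 \<Longrightarrow> \<exists>N. \<forall>i\<ge>N. \<forall>j\<ge>N. L2_sq (\<lambda>\<zeta>. s i \<zeta> - s j \<zeta>) < e"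
  obtains \<phi> where "\<phi> \<in> L2_circle" "(\<lambda>n. L2_sq (\<lambda>\<zeta>. s n \<zeta> - \<phi> \<zeta>)) \<longlonglongrightarrow> 0"
proof -
  have one: "(\<lambda>_. 1) \<in> L2_circle" by (intro L2_continuous continuous_intros)
  have one_sq: "L2_sq (\<lambda>_. 1) = 1" by (simp add: L2_sq_def measure_circle_measure)
  note [measurable] = s[THEN L2_measurable]
  have int: "integrable circle_measure (s n)" for n
    using L2_Cauchy_Schwarz(1)[OF s one, of n] by simp
  have L1: "\<exists>N. \<forall>i\<ge>N. \<forall>j\<ge>N. (LINT \<zeta>|circle_measure. norm (s i \<zeta> - s j \<zeta>)) < e" if "e > 0" for e
  proof -
    obtain N where N: "\<And>i j. i \<ge> N \<Longrightarrow> j \<ge> N \<Longrightarrow> L2_sq (\<lambda>\<zeta>. s i \<zeta> - s j \<zeta>) < e\<^sup>2"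
      using cauchy[of "e\<^sup>2"] \<open>e > 0\<close> by auto
    have "(LINT \<zeta>|circle_measure. norm (s i \<zeta> - s j \<zeta>)) < e" if "i \<ge> N" "j \<ge> N" for i j
    proof (rule power2_less_imp_less)
      show "(LINT \<zeta>|circle_measure. norm (s i \<zeta> - s j \<zeta>))\<^sup>2 < e\<^sup>2"
        using L2_Cauchy_Schwarz(2)[OF L2_diff[OF s s] one, of i j] N[OF that] by (simp add: one_sq)
    qed (use \<open>e > 0\<close> in simp)
    then show ?thesis by blast
  qed
  obtain r where r: "strict_mono r" "AE \<zeta> in circle_measure. Cauchy (\<lambda>i. s (r i) \<zeta>)"
    using cauchy_L1_AE_cauchy_subseq[OF int L1] by blast
  define \<phi> where "\<phi> = (\<lambda>\<zeta>. lim (\<lambda>i. s (r i) \<zeta>))"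
  have [measurable]: "\<phi> \<in> borel_measurable circle_measure"
    unfolding \<phi>_def by measurable
  have conv: "AE \<zeta> in circle_measure. (\<lambda>i. s (r i) \<zeta>) \<longlonglongrightarrow> \<phi> \<zeta>"
    using r(2) by eventually_elim (simp add: \<phi>_def Cauchy_convergent_iff convergent_LIMSEQ_iff)
  have key: "(\<lambda>\<zeta>. s n \<zeta> - \<phi> \<zeta>) \<in> L2_circle \<and> L2_sq (\<lambda>\<zeta>. s n \<zeta> - \<phi> \<zeta>) \<le> e"
    if n: "n \<ge> N" and e: "e > 0" and N: "\<forall>i\<ge>N. \<forall>j\<ge>N. L2_sq (\<lambda>\<zeta>. s i \<zeta> - s j \<zeta>) < e" for n N e
  proof -
    have "(\<integral>\<^sup>+\<zeta>. ennreal ((norm (s n \<zeta> - \<phi> \<zeta>))\<^sup>2) \<partial>circle_measure)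
        = (\<integral>\<^sup>+\<zeta>. liminf (\<lambda>i. ennreal ((norm (s n \<zeta> - s (r i) \<zeta>))\<^sup>2)) \<partial>circle_measure)"
    proof (rule nn_integral_cong_AE)
      show "AE \<zeta> in circle_measure. ennreal ((norm (s n \<zeta> - \<phi> \<zeta>))\<^sup>2)
          = liminf (\<lambda>i. ennreal ((norm (s n \<zeta> - s (r i) \<zeta>))\<^sup>2))"
        using conv
      proof eventually_elim
        case (elim \<zeta>)
        have "(\<lambda>i. ennreal ((norm (s n \<zeta> - s (r i) \<zeta>))\<^sup>2)) \<longlonglongrightarrow> ennreal ((norm (s n \<zeta> - \<phi> \<zeta>))\<^sup>2)"
          by (intro tendsto_intros elim tendsto_ennrealI)
        then show ?case by (intro lim_imp_Liminf[symmetric]) auto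
      qed
    qed
    also have "\<dots> \<le> liminf (\<lambda>i. \<integral>\<^sup>+\<zeta>. ennreal ((norm (s n \<zeta> - s (r i) \<zeta>))\<^sup>2) \<partial>circle_measure)"
      by (rule nn_integral_liminf) measurable
    also have "\<dots> \<le> liminf (\<lambda>i. ennreal e)"
    proof (rule Liminf_mono)
      show "\<forall>\<^sub>F i in sequentially. (\<integral>\<^sup>+\<zeta>. ennreal ((norm (s n \<zeta> - s (r i) \<zeta>))\<^sup>2) \<partial>circle_measure) \<le> ennreal e"
        using eventually_ge_at_top[of N]
      proof eventually_elim
        case (elim i)
        then have "r i \<ge> N" using seq_suble[OF r(1), of i] by linarith
        then have "L2_sq (\<lambda>\<zeta>. s n \<zeta> - s (r i) \<zeta>) < e" using N n by blast
        then show ?case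
          using nn_integral_eq_integral[OF L2_integrable[OF L2_diff[OF s s]], of n "r i"]
          by (simp add: L2_sq_def ennreal_leI)
      qed
    qed
    also have "\<dots> = ennreal e" by (simp add: Liminf_const)
    finally have le: "(\<integral>\<^sup>+\<zeta>. ennreal ((norm (s n \<zeta> - \<phi> \<zeta>))\<^sup>2) \<partial>circle_measure) \<le> ennreal e" .
    then have "(\<integral>\<^sup>+\<zeta>. ennreal ((norm (s n \<zeta> - \<phi> \<zeta>))\<^sup>2) \<partial>circle_measure) < \<infinity>"
      by (rule order.strict_trans1) simp
    then have i: "integrable circle_measure (\<lambda>\<zeta>. (norm (s n \<zeta> - \<phi> \<zeta>))\<^sup>2)"
      by (intro integrableI_nonneg) auto
    have "L2_sq (\<lambda>\<zeta>. s n \<zeta> - \<phi> \<zeta>) \<le> e"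
      using le e unfolding L2_sq_def by (simp add: nn_integral_eq_integral[OF i])
    with i show ?thesis by (simp add: L2_circle_def)
  qed
  have "\<phi> \<in> L2_circle"
  proof -
    obtain N where "\<forall>i\<ge>N. \<forall>j\<ge>N. L2_sq (\<lambda>\<zeta>. s i \<zeta> - s j \<zeta>) < 1" using cauchy[of 1] by auto
    from L2_diff[OF s[of N] key[OF _ _ this, THEN conjunct1, of N]] show ?thesis by simp
  qed
  moreover have "(\<lambda>n. L2_sq (\<lambda>\<zeta>. s n \<zeta> - \<phi> \<zeta>)) \<longlonglongrightarrow> 0"
  proof (rule LIMSEQ_I)
    fix e :: real assume e: "e > 0"
    obtain N where "\<forall>i\<ge>N. \<forall>j\<ge>N. L2_sq (\<lambda>\<zeta>. s i \<zeta> - s j \<zeta>) < e/2" using cauchy[of "e/2"] e by auto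
    from key[OF _ _ this] e have "\<forall>n\<ge>N. L2_sq (\<lambda>\<zeta>. s n \<zeta> - \<phi> \<zeta>) \<le> e/2" by auto
    then show "\<exists>no. \<forall>n\<ge>no. norm (L2_sq (\<lambda>\<zeta>. s n \<zeta> - \<phi> \<zeta>) - 0) < e"
      using e by (intro exI[of _ N]) fastforce
  qed
  ultimately show thesis by (rule that)
qed

section \<open>Fourier series and Taylor coefficients\<close>

lemma monomial_L2: "(\<lambda>\<zeta>. \<zeta> ^ n) \<in> L2_circle"
  by (intro L2_continuous continuous_intros)

lemma L2_inner_monomials: "L2_inner (\<lambda>\<zeta>. \<zeta> ^ k) (\<lambda>\<zeta>. \<zeta> ^ m) = (if k = m then 1 else 0)"
  unfolding L2_inner_def by (rule integral_circle_monomials)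

text \<open>The partial sums converge uniformly, hence in \<open>L\<^sup>2\<close>, so inner products may be computed term by
  term; orthonormality of the monomials then gives the coefficients and Parseval's identity.\<close>

lemma absolutely_summable_Fourier_series:
  fixes c :: "nat \<Rightarrow> complex"
  assumes c: "summable (\<lambda>n. norm (c n))"
    and g: "\<And>\<zeta>. norm \<zeta> = 1 \<Longrightarrow> (\<lambda>n. c n * \<zeta> ^ n) sums g \<zeta>"
  shows Fourier_series_continuous: "continuous_on (sphere 0 1) g"
    and Fourier_series_inner: "\<And>\<psi>. \<psi> \<in> L2_circle \<Longrightarrow> (\<lambda>n. c n * L2_inner (\<lambda>\<zeta>. \<zeta> ^ n) \<psi>) sums L2_inner g \<psi>"
    and Fourier_series_coefficient: "\<And>m. L2_inner g (\<lambda>\<zeta>. \<zeta> ^ m) = c m"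
    and Fourier_series_Parseval: "(\<lambda>n. (norm (c n))\<^sup>2) sums L2_sq g"
proof -
  have ul: "uniform_limit (sphere 0 1) (\<lambda>n \<zeta>. \<Sum>i<n. c i * \<zeta> ^ i) g sequentially"
  proof -
    have "uniform_limit (sphere 0 1) (\<lambda>n \<zeta>. \<Sum>i<n. c i * \<zeta> ^ i) (\<lambda>\<zeta>. \<Sum>i. c i * \<zeta> ^ i) sequentially"
      by (rule Weierstrass_m_test[OF _ c]) (simp add: norm_mult norm_power)
    then show ?thesis
      by (rule uniform_limit_cong'[THEN iffD1, rotated 2]) (use sums_unique[OF g] in auto)
  qed
  show cont: "continuous_on (sphere 0 1) g"
    by (rule uniform_limit_theorem[OF _ ul]) (auto intro!: always_eventually continuous_intros)
  have pL2: "(\<lambda>\<zeta>. \<Sum>i<n. c i * \<zeta> ^ i) \<in> L2_circle" for n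
    by (intro L2_continuous continuous_intros)
  have gL2: "g \<in> L2_circle" by (rule L2_continuous[OF cont])
  have lim: "(\<lambda>n. L2_sq (\<lambda>\<zeta>. (\<Sum>i<n. c i * \<zeta> ^ i) - g \<zeta>)) \<longlonglongrightarrow> 0"
  proof (rule LIMSEQ_I)
    fix e :: real assume e: "e > 0"
    define d where "d = sqrt (e / 2)"
    have d: "d > 0" "d\<^sup>2 < e" using e by (auto simp: d_def)
    from uniform_limitD[OF ul d(1)] obtain N where
      N: "\<forall>n\<ge>N. \<forall>\<zeta>\<in>sphere 0 1. dist (\<Sum>i<n. c i * \<zeta> ^ i) (g \<zeta>) < d"
      unfolding eventually_sequentially by blast
    have "L2_sq (\<lambda>\<zeta>. (\<Sum>i<n. c i * \<zeta> ^ i) - g \<zeta>) \<le> d\<^sup>2" if "n \<ge> N" for n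
    proof -
      have "L2_sq (\<lambda>\<zeta>. (\<Sum>i<n. c i * \<zeta> ^ i) - g \<zeta>) \<le> (LINT \<zeta>|circle_measure. d\<^sup>2)"
        unfolding L2_sq_def
      proof (rule integral_mono)
        show "integrable circle_measure (\<lambda>\<zeta>. (cmod ((\<Sum>i<n. c i * \<zeta> ^ i) - g \<zeta>))\<^sup>2)"
          by (rule L2_integrable[OF L2_diff[OF pL2 gL2]])
        show "(cmod ((\<Sum>i<n. c i * \<zeta> ^ i) - g \<zeta>))\<^sup>2 \<le> d\<^sup>2" if "\<zeta> \<in> space circle_measure" for \<zeta>
          using N that \<open>n \<ge> N\<close>
          by (intro power_mono) (auto simp: space_circle_measure dist_norm less_imp_le)
      qed simp
      then show ?thesis by (simp add: measure_circle_measure)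
    qed
    then show "\<exists>no. \<forall>n\<ge>no. norm (L2_sq (\<lambda>\<zeta>. (\<Sum>i<n. c i * \<zeta> ^ i) - g \<zeta>) - 0) < e"
      using d(2) by (intro exI[of _ N]) fastforce
  qed
  show inner: "(\<lambda>n. c n * L2_inner (\<lambda>\<zeta>. \<zeta> ^ n) \<psi>) sums L2_inner g \<psi>" if \<psi>: "\<psi> \<in> L2_circle" for \<psi>
  proof -
    have partial: "L2_inner (\<lambda>\<zeta>. \<Sum>i<n. c i * \<zeta> ^ i) \<psi> = (\<Sum>i<n. c i * L2_inner (\<lambda>\<zeta>. \<zeta> ^ i) \<psi>)" for n
    proof (induction n)
      case 0
      then show ?case by (simp add: L2_inner_def)
    next
      case (Suc n)
      then show ?case
        by (simp add: L2_inner_add_left pL2 L2_scale monomial_L2 \<psi> L2_inner_scale_left)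
    qed
    have "(\<lambda>n. L2_inner (\<lambda>\<zeta>. \<Sum>i<n. c i * \<zeta> ^ i) \<psi>) \<longlonglongrightarrow> L2_inner g \<psi>"
      by (rule L2_inner_tendsto[OF _ gL2 \<psi> lim]) (simp add: pL2)
    then show ?thesis by (simp add: sums_def partial)
  qed
  show coeff: "L2_inner g (\<lambda>\<zeta>. \<zeta> ^ m) = c m" for m
  proof -
    have "(\<lambda>n. if n = m then c n else 0) sums L2_inner g (\<lambda>\<zeta>. \<zeta> ^ m)"
      using inner[OF monomial_L2, of m] by (simp add: L2_inner_monomials if_distrib cong: if_cong)
    then show ?thesis
      using sums_single[of m c] sums_unique2 by blast
  qed
  have "(\<lambda>n. c n * L2_inner (\<lambda>\<zeta>. \<zeta> ^ n) g) sums L2_inner g g" by (rule inner[OF gL2])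
  also have "(\<lambda>n. c n * L2_inner (\<lambda>\<zeta>. \<zeta> ^ n) g) = (\<lambda>n. of_real ((norm (c n))\<^sup>2))"
    using coeff by (simp add: L2_inner_commute[of _ g] flip: complex_norm_square)
  finally show "(\<lambda>n. (norm (c n))\<^sup>2) sums L2_sq g"
    unfolding L2_inner_self by (simp only: sums_of_real_iff)
qed

definition taylor :: "(complex \<Rightarrow> complex) \<Rightarrow> nat \<Rightarrow> complex" where
  "taylor f n = (deriv ^^ n) f 0 / fact n"

lemma taylor_sums:
  assumes "f holomorphic_on ball 0 1" "norm z < 1"
  shows "(\<lambda>n. taylor f n * z ^ n) sums f z"
  using holomorphic_power_series[OF assms(1), of z] assms(2) by (simp add: taylor_def)

lemma power_series_dilate:
  fixes c :: "nat \<Rightarrow> complex"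
  assumes s: "\<And>z. norm z < 1 \<Longrightarrow> (\<lambda>n. c n * z ^ n) sums f z" and r: "0 \<le> r" "r < (1::real)"
  shows "summable (\<lambda>n. norm (c n * of_real r ^ n))"
    and "norm \<zeta> = 1 \<Longrightarrow> (\<lambda>n. (c n * of_real r ^ n) * \<zeta> ^ n) sums f (of_real r * \<zeta>)"
proof -
  define t where "t = (1 + r) / 2"
  have "norm (of_real r :: complex) < norm (of_real t :: complex)" "norm (of_real t :: complex) < 1"
    unfolding norm_of_real using r by (auto simp: t_def)
  then show "summable (\<lambda>n. norm (c n * of_real r ^ n))"
    using powser_insidea[of c "of_real t" "of_real r"] s[of "of_real t"] sums_summable by blast
  show "(\<lambda>n. (c n * of_real r ^ n) * \<zeta> ^ n) sums f (of_real r * \<zeta>)" if "norm \<zeta> = 1"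
    using s[of "of_real r * \<zeta>"] r that by (simp add: norm_mult power_mult_distrib mult.assoc)
qed

text \<open>Two power series with the same sum have the same Fourier coefficients on a smaller circle.\<close>

lemma taylor_eqI:
  assumes s: "\<And>z. norm z < 1 \<Longrightarrow> (\<lambda>n. c n * z ^ n) sums f z"
  shows "f holomorphic_on ball 0 1" and "taylor f = c"
proof -
  show hol: "f holomorphic_on ball 0 1"
    by (rule power_series_holomorphic[where a=c]) (use s in simp)
  have "taylor f m = c m" for m
  proof -
    have "L2_inner (\<lambda>\<zeta>. f (of_real (1/2) * \<zeta>)) (\<lambda>\<zeta>. \<zeta> ^ m) = c m * of_real (1/2) ^ m"
      by (rule Fourier_series_coefficient; rule power_series_dilate) (use s in auto)
    moreover have "L2_inner (\<lambda>\<zeta>. f (of_real (1/2) * \<zeta>)) (\<lambda>\<zeta>. \<zeta> ^ m) = taylor f m * of_real (1/2) ^ m"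
      by (rule Fourier_series_coefficient; rule power_series_dilate) (use taylor_sums[OF hol] in auto)
    ultimately show ?thesis by simp
  qed
  then show "taylor f = c" by auto
qed

lemma dilate_properties:
  assumes hol: "f holomorphic_on ball 0 1" and r: "0 \<le> r" "r < (1::real)"
  shows dilate_L2: "(\<lambda>\<zeta>. f (of_real r * \<zeta>)) \<in> L2_circle"
    and dilate_inner: "\<And>\<psi>. \<psi> \<in> L2_circle \<Longrightarrow>
      (\<lambda>n. (taylor f n * of_real r ^ n) * L2_inner (\<lambda>\<zeta>. \<zeta> ^ n) \<psi>) sums L2_inner (\<lambda>\<zeta>. f (of_real r * \<zeta>)) \<psi>"
    and dilate_coefficient: "\<And>m. L2_inner (\<lambda>\<zeta>. f (of_real r * \<zeta>)) (\<lambda>\<zeta>. \<zeta> ^ m) = taylor f m * of_real r ^ m"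
    and dilate_Parseval: "(\<lambda>n. (norm (taylor f n))\<^sup>2 * (r ^ n)\<^sup>2) sums L2_sq (\<lambda>\<zeta>. f (of_real r * \<zeta>))"
proof -
  note * = power_series_dilate[where c="taylor f", OF taylor_sums[OF hol] r]
  show "(\<lambda>\<zeta>. f (of_real r * \<zeta>)) \<in> L2_circle"
    by (rule L2_continuous, rule Fourier_series_continuous; rule *)
  show "\<And>\<psi>. \<psi> \<in> L2_circle \<Longrightarrow>
      (\<lambda>n. (taylor f n * of_real r ^ n) * L2_inner (\<lambda>\<zeta>. \<zeta> ^ n) \<psi>) sums L2_inner (\<lambda>\<zeta>. f (of_real r * \<zeta>)) \<psi>"
    by (rule Fourier_series_inner; (rule *)?)
  show "\<And>m. L2_inner (\<lambda>\<zeta>. f (of_real r * \<zeta>)) (\<lambda>\<zeta>. \<zeta> ^ m) = taylor f m * of_real r ^ m"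
    by (rule Fourier_series_coefficient; rule *)
  have "(\<lambda>n. (norm (taylor f n * of_real r ^ n))\<^sup>2) sums L2_sq (\<lambda>\<zeta>. f (of_real r * \<zeta>))"
    by (rule Fourier_series_Parseval; rule *)
  then show "(\<lambda>n. (norm (taylor f n))\<^sup>2 * (r ^ n)\<^sup>2) sums L2_sq (\<lambda>\<zeta>. f (of_real r * \<zeta>))"
    using r by (simp add: norm_mult norm_power power_mult_distrib)
qed

lemma dilate_diff_Parseval:
  assumes hol: "f holomorphic_on ball 0 1" and r: "0 \<le> r" "r < (1::real)" and t: "0 \<le> t" "t < (1::real)"
  shows "(\<lambda>n. (norm (taylor f n))\<^sup>2 * (r ^ n - t ^ n)\<^sup>2) sums L2_sq (\<lambda>\<zeta>. f (of_real r * \<zeta>) - f (of_real t * \<zeta>))"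
proof -
  note * = power_series_dilate[where c="taylor f", OF taylor_sums[OF hol]]
  have "(\<lambda>n. (norm (taylor f n * of_real r ^ n - taylor f n * of_real t ^ n))\<^sup>2)
      sums L2_sq (\<lambda>\<zeta>. f (of_real r * \<zeta>) - f (of_real t * \<zeta>))"
  proof (rule Fourier_series_Parseval)
    show "summable (\<lambda>n. norm (taylor f n * of_real r ^ n - taylor f n * of_real t ^ n))"
      by (rule summable_comparison_test'[OF summable_add[OF *(1)[OF _ r] *(1)[OF _ t]]])
         (auto intro: norm_triangle_ineq4)
    show "(\<lambda>n. (taylor f n * of_real r ^ n - taylor f n * of_real t ^ n) * \<zeta> ^ n)
        sums (f (of_real r * \<zeta>) - f (of_real t * \<zeta>))" if "norm \<zeta> = 1" for \<zeta>
      using sums_diff[OF *(2)[OF _ r that] *(2)[OF _ t that]] by (simp add: left_diff_distrib)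
  qed
  moreover have "norm (taylor f n * of_real r ^ n - taylor f n * of_real t ^ n) = norm (taylor f n) * \<bar>r ^ n - t ^ n\<bar>" for n
    by (metis norm_mult norm_of_real of_real_diff of_real_power right_diff_distrib)
  ultimately show ?thesis by (simp add: power_mult_distrib)
qed

section \<open>The Hardy space and its boundary functions\<close>

lemma hardy2_holomorphic: "f \<in> hardy2 \<Longrightarrow> f holomorphic_on ball 0 1"
  by (simp add: hardy2_def)

lemma hardy2_outside: "f \<in> hardy2 \<Longrightarrow> \<not> norm z < 1 \<Longrightarrow> f z = 0"
  by (simp add: hardy2_def)

lemmas hardy2_sums = taylor_sums[OF hardy2_holomorphic]

text \<open>Parseval expresses the mean of \<open>\<bar>f\<bar>\<^sup>2\<close> over the circle of radius \<open>r\<close> by the Taylor coefficients. Its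
  boundedness in \<open>r < 1\<close> is inherited, as \<open>r\<close> tends to \<open>1\<close>, by the partial sums at \<open>r = 1\<close>; conversely the sum at
  \<open>r = 1\<close> is an upper bound.\<close>

lemma hardy2_iff:
  "f \<in> hardy2 \<longleftrightarrow> f holomorphic_on ball 0 1 \<and> (\<forall>z. \<not> norm z < 1 \<longrightarrow> f z = 0) \<and>
     summable (\<lambda>n. (norm (taylor f n))\<^sup>2)"
proof -
  have "bdd_above ((\<lambda>r::real. L2_sq (\<lambda>\<zeta>. f (of_real r * \<zeta>))) ` {0..<1}) \<longleftrightarrow> summable (\<lambda>n. (norm (taylor f n))\<^sup>2)"
    if hol: "f holomorphic_on ball 0 1"
  proof
    assume "bdd_above ((\<lambda>r::real. L2_sq (\<lambda>\<zeta>. f (of_real r * \<zeta>))) ` {0..<1})"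
    then obtain B where "\<forall>r\<in>{0..<1}. L2_sq (\<lambda>\<zeta>. f (of_real r * \<zeta>)) \<le> B"
      by (auto simp: bdd_above_def)
    then have B: "L2_sq (\<lambda>\<zeta>. f (of_real r * \<zeta>)) \<le> B" if "0 \<le> r" "r < 1" for r :: real
      using that by simp
    have "(\<Sum>n<N. (norm (taylor f n))\<^sup>2) \<le> B" for N
    proof (rule tendsto_upperbound)
      have "((\<lambda>r::real. \<Sum>n<N. (norm (taylor f n))\<^sup>2 * (r ^ n)\<^sup>2) \<longlongrightarrow> (\<Sum>n<N. (norm (taylor f n))\<^sup>2 * (1 ^ n)\<^sup>2)) (at_left 1)"
        by (intro tendsto_intros)
      then show "((\<lambda>r::real. \<Sum>n<N. (norm (taylor f n))\<^sup>2 * (r ^ n)\<^sup>2) \<longlongrightarrow> (\<Sum>n<N. (norm (taylor f n))\<^sup>2)) (at_left 1)"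
        by simp
      have "\<forall>\<^sub>F r::real in at_left 1. r \<in> {0<..<1}"
        by (rule eventually_at_left_real) simp
      then show "\<forall>\<^sub>F r::real in at_left 1. (\<Sum>n<N. (norm (taylor f n))\<^sup>2 * (r ^ n)\<^sup>2) \<le> B"
      proof eventually_elim
        case (elim r)
        then have "(\<Sum>n<N. (norm (taylor f n))\<^sup>2 * (r ^ n)\<^sup>2) \<le> L2_sq (\<lambda>\<zeta>. f (of_real r * \<zeta>))"
          by (intro sum_le_suminf[THEN order_trans, OF _ _ _ eq_refl[OF sums_unique[symmetric]]]
               sums_summable[OF dilate_Parseval[OF hol]] dilate_Parseval[OF hol]) auto
        also have "\<dots> \<le> B" using elim by (intro B) auto
        finally show ?case .
      qed
    qed auto
    then show "summable (\<lambda>n. (norm (taylor f n))\<^sup>2)"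
      by (intro bounded_imp_summable[where B=B])
         (auto simp del: sum.lessThan_Suc simp flip: lessThan_Suc_atMost)
  next
    assume s: "summable (\<lambda>n. (norm (taylor f n))\<^sup>2)"
    show "bdd_above ((\<lambda>r::real. L2_sq (\<lambda>\<zeta>. f (of_real r * \<zeta>))) ` {0..<1})"
    proof (rule bdd_aboveI2)
      fix r :: real assume "r \<in> {0..<1}"
      then have r: "0 \<le> r" "r < 1" by auto
      show "L2_sq (\<lambda>\<zeta>. f (of_real r * \<zeta>)) \<le> (\<Sum>n. (norm (taylor f n))\<^sup>2)"
        by (rule sums_le[OF _ dilate_Parseval[OF hol r] summable_sums[OF s]])
           (use r in \<open>auto intro!: mult_left_le power_le_one\<close>)
    qed
  qed
  then show ?thesis by (auto simp: hardy2_def L2_sq_def)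
qed

lemma hardy2_summable: "f \<in> hardy2 \<Longrightarrow> summable (\<lambda>n. (norm (taylor f n))\<^sup>2)"
  by (simp add: hardy2_iff)

lemma hardy2I:
  assumes s: "\<And>z. norm z < 1 \<Longrightarrow> (\<lambda>n. c n * z ^ n) sums f z"
    and "\<And>z. \<not> norm z < 1 \<Longrightarrow> f z = 0" and "summable (\<lambda>n. (norm (c n))\<^sup>2)"
  shows "f \<in> hardy2" "taylor f = c"
proof -
  note taylor_eqI[OF s]
  then show "f \<in> hardy2" "taylor f = c" using assms by (simp_all add: hardy2_iff)
qed

lemma hardy2_eqI:
  assumes "f \<in> hardy2" "g \<in> hardy2" "taylor f = taylor g"
  shows "f = g"
proof
  fix z
  show "f z = g z"
  proof (cases "norm z < 1")
    case True
    then show ?thesis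
      using hardy2_sums[OF assms(1) True] hardy2_sums[OF assms(2) True] assms(3)
      by (simp add: sums_unique2)
  qed (simp add: assms hardy2_outside)
qed

text \<open>For \<open>\<bar>z\<bar> < 1\<close> the power series converges, as \<open>\<bar>c\<^sub>n z\<^sup>n\<bar> \<le> \<bar>c\<^sub>n\<bar>\<^sup>2 + \<bar>z\<^sup>n\<bar>\<^sup>2\<close>.\<close>

lemma hardy2_of_coefficients:
  assumes c: "summable (\<lambda>n. (norm (c n :: complex))\<^sup>2)"
  obtains f where "f \<in> hardy2" "taylor f = c"
proof -
  define f where "f = (\<lambda>z. if norm z < 1 then (\<Sum>n. c n * z ^ n) else 0)"
  have "(\<lambda>n. c n * z ^ n) sums f z" if z: "norm z < 1" for z
  proof -
    have "summable (\<lambda>n. (norm (c n))\<^sup>2 + (norm z ^ n)\<^sup>2)"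
    proof (rule summable_add[OF c])
      have "(norm z)\<^sup>2 < 1" using z by (simp add: power_less_one_iff)
      then show "summable (\<lambda>n. (norm z ^ n)\<^sup>2)"
        using summable_geometric[of "(norm z)\<^sup>2"] by (simp add: power_mult[symmetric] mult.commute)
    qed
    then have "summable (\<lambda>n. c n * z ^ n)"
    proof (rule summable_comparison_test')
      show "norm (c n * z ^ n) \<le> (norm (c n))\<^sup>2 + (norm z ^ n)\<^sup>2" if "n \<ge> 0" for n
      proof -
        have "0 \<le> norm (c n) * norm z ^ n" by simp
        then show ?thesis
          using sum_squares_bound[of "norm (c n)" "norm z ^ n"]
          unfolding norm_mult norm_power by linarith
      qed
    qed
    then show ?thesis using z by (simp add: f_def summable_sums)
  qed
  from hardy2I[OF this _ c] show thesis by (intro that[of f]) (auto simp: f_def)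
qed

lemma eventually_at_left_1: "\<forall>\<^sub>F r::real in at_left 1. 0 < r \<and> r < 1"
  using eventually_at_left_real[of 0 "1::real"] by simp

text \<open>Dominated convergence for series, as the parameter \<open>r\<close> increases to \<open>1\<close>.\<close>

lemma tendsto_suminf_at_left_1:
  fixes a :: "nat \<Rightarrow> real \<Rightarrow> 'a::{real_normed_algebra,banach}"
  assumes lim: "\<And>k. ((\<lambda>r. a k r) \<longlongrightarrow> b k) (at_left 1)"
    and bound: "\<And>k r. 0 < r \<Longrightarrow> r < 1 \<Longrightarrow> norm (a k r) \<le> M k" and M: "summable M"
  shows "((\<lambda>r. \<Sum>k. a k r) \<longlongrightarrow> (\<Sum>k. b k)) (at_left 1)"
proof -
  have "\<forall>\<^sub>F (k::nat, r) in at_top \<times>\<^sub>F at_left 1. 0 < r \<and> r < (1::real)"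
    using eventually_at_left_1 by (subst eventually_prod2) auto
  then have "\<forall>\<^sub>F (k, r) in at_top \<times>\<^sub>F at_left 1. norm (a k r) \<le> M k"
    by eventually_elim (use bound in auto)
  from tannerys_theorem[OF lim this M] show ?thesis by (simp add: trivial_limit_at_left_real)
qed

text \<open>By Parseval this is the squared \<open>L\<^sup>2\<close> distance from the dilate \<open>\<zeta> \<mapsto> f (r \<zeta>)\<close> to the boundary
  function of \<open>f\<close>. Being defined by coefficients, it is available before the boundary function is known
  to exist.\<close>

definition dilation_defect :: "(complex \<Rightarrow> complex) \<Rightarrow> real \<Rightarrow> real" where
  "dilation_defect f r = (\<Sum>n. (norm (taylor f n))\<^sup>2 * (1 - r ^ n)\<^sup>2)"

lemma dilation_defect_summable:
  assumes "f \<in> hardy2" "0 \<le> r" "r < 1"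
  shows "summable (\<lambda>n. (norm (taylor f n))\<^sup>2 * (1 - r ^ n)\<^sup>2)"
proof (rule summable_comparison_test'[OF hardy2_summable[OF assms(1)]])
  show "norm ((norm (taylor f n))\<^sup>2 * (1 - r ^ n)\<^sup>2) \<le> (norm (taylor f n))\<^sup>2" if "n \<ge> 0" for n
    using assms by (auto intro!: mult_left_le power_le_one simp: abs_mult)
qed

lemma dilation_defect_tendsto_0:
  assumes f: "f \<in> hardy2"
  shows "(dilation_defect f \<longlongrightarrow> 0) (at_left 1)"
proof -
  have "((\<lambda>r. \<Sum>n. (norm (taylor f n))\<^sup>2 * (1 - r ^ n)\<^sup>2) \<longlongrightarrow> (\<Sum>n. (norm (taylor f n))\<^sup>2 * (1 - 1 ^ n)\<^sup>2)) (at_left 1)"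
  proof (rule tendsto_suminf_at_left_1[OF _ _ hardy2_summable[OF f]])
    show "((\<lambda>r. (norm (taylor f k))\<^sup>2 * (1 - r ^ k)\<^sup>2) \<longlongrightarrow> (norm (taylor f k))\<^sup>2 * (1 - 1 ^ k)\<^sup>2) (at_left 1)" for k
      by (intro tendsto_intros)
  qed (auto intro!: mult_left_le power_le_one simp: abs_mult)
  then show ?thesis by (simp add: dilation_defect_def[abs_def])
qed

lemma dilate_diff_le:
  assumes f: "f \<in> hardy2" and r: "0 \<le> r" "r < 1" and t: "0 \<le> t" "t < 1"
  shows "L2_sq (\<lambda>\<zeta>. f (of_real r * \<zeta>) - f (of_real t * \<zeta>)) \<le> 2 * dilation_defect f r + 2 * dilation_defect f t"
proof (rule sums_le[OF _ dilate_diff_Parseval[OF hardy2_holomorphic[OF f] r t]])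
  show "(\<lambda>n. 2 * ((norm (taylor f n))\<^sup>2 * (1 - r ^ n)\<^sup>2) + 2 * ((norm (taylor f n))\<^sup>2 * (1 - t ^ n)\<^sup>2))
      sums (2 * dilation_defect f r + 2 * dilation_defect f t)"
    unfolding dilation_defect_def
    by (intro sums_add sums_mult summable_sums dilation_defect_summable f r t)
  show "(norm (taylor f n))\<^sup>2 * (r ^ n - t ^ n)\<^sup>2
      \<le> 2 * ((norm (taylor f n))\<^sup>2 * (1 - r ^ n)\<^sup>2) + 2 * ((norm (taylor f n))\<^sup>2 * (1 - t ^ n)\<^sup>2)" for n
  proof -
    have "(r ^ n - t ^ n)\<^sup>2 \<le> 2 * (1 - r ^ n)\<^sup>2 + 2 * (1 - t ^ n)\<^sup>2"
      using zero_le_power2[of "(1 - r ^ n) + (1 - t ^ n)"] by (simp add: power2_eq_square algebra_simps)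
    from mult_left_mono[OF this, of "(norm (taylor f n))\<^sup>2"] show ?thesis by (simp add: algebra_simps)
  qed
qed

text \<open>The dilates along one sequence of radii form a Cauchy sequence by Parseval, hence have a limit \<open>\<phi>\<close> by
  completeness; comparing an arbitrary dilate with that sequence yields convergence for all radii.\<close>

lemma boundary_exists:
  assumes f: "f \<in> hardy2"
  shows "\<exists>\<phi>. has_boundary f \<phi>"
proof -
  define r where "r k = 1 - 1 / (real k + 2)" for k :: nat
  have r: "0 \<le> r k" "r k < 1" for k by (auto simp: r_def field_simps)
  have L2: "(\<lambda>\<zeta>. f (of_real t * \<zeta>)) \<in> L2_circle" if "0 \<le> t" "t < 1" for t
    by (rule dilate_L2[OF hardy2_holomorphic[OF f] that])
  have "filterlim r (at_left 1) sequentially"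
    unfolding r_def by real_asymp
  then have lim_r: "(\<lambda>k. dilation_defect f (r k)) \<longlonglongrightarrow> 0"
    by (rule filterlim_compose[OF dilation_defect_tendsto_0[OF f]])
  obtain \<phi> where \<phi>: "\<phi> \<in> L2_circle" "(\<lambda>k. L2_sq (\<lambda>\<zeta>. f (of_real (r k) * \<zeta>) - \<phi> \<zeta>)) \<longlonglongrightarrow> 0"
  proof (rule L2_complete[of "\<lambda>k \<zeta>. f (of_real (r k) * \<zeta>)"])
    show "(\<lambda>\<zeta>. f (of_real (r n) * \<zeta>)) \<in> L2_circle" for n by (intro L2 r)
    fix e :: real assume "e > 0"
    then obtain N where N: "\<And>k. k \<ge> N \<Longrightarrow> dilation_defect f (r k) < e / 4"
      using order_tendstoD(2)[OF lim_r, of "e/4"] by (auto simp: eventually_sequentially)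
    have "L2_sq (\<lambda>\<zeta>. f (of_real (r i) * \<zeta>) - f (of_real (r j) * \<zeta>)) < e" if "i \<ge> N" "j \<ge> N" for i j
      using dilate_diff_le[OF f r r, of i j] N[OF that(1)] N[OF that(2)] by simp
    then show "\<exists>N. \<forall>i\<ge>N. \<forall>j\<ge>N. L2_sq (\<lambda>\<zeta>. f (of_real (r i) * \<zeta>) - f (of_real (r j) * \<zeta>)) < e"
      by blast
  qed blast
  have le: "L2_sq (\<lambda>\<zeta>. f (of_real t * \<zeta>) - \<phi> \<zeta>) \<le> 4 * dilation_defect f t" if t: "0 \<le> t" "t < 1" for t
  proof (rule tendsto_lowerbound)
    have "(\<lambda>k. 2 * (2 * dilation_defect f t + 2 * dilation_defect f (r k)) +
          2 * L2_sq (\<lambda>\<zeta>. f (of_real (r k) * \<zeta>) - \<phi> \<zeta>)) \<longlonglongrightarrow> 2 * (2 * dilation_defect f t + 2 * 0) + 2 * 0"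
      by (intro tendsto_intros lim_r \<phi>)
    then show "(\<lambda>k. 2 * (2 * dilation_defect f t + 2 * dilation_defect f (r k)) +
          2 * L2_sq (\<lambda>\<zeta>. f (of_real (r k) * \<zeta>) - \<phi> \<zeta>)) \<longlonglongrightarrow> 4 * dilation_defect f t" by simp
    show "\<forall>\<^sub>F k in sequentially. L2_sq (\<lambda>\<zeta>. f (of_real t * \<zeta>) - \<phi> \<zeta>)
        \<le> 2 * (2 * dilation_defect f t + 2 * dilation_defect f (r k)) +
          2 * L2_sq (\<lambda>\<zeta>. f (of_real (r k) * \<zeta>) - \<phi> \<zeta>)"
    proof (rule always_eventually, rule allI)
      fix k
      show "L2_sq (\<lambda>\<zeta>. f (of_real t * \<zeta>) - \<phi> \<zeta>)
        \<le> 2 * (2 * dilation_defect f t + 2 * dilation_defect f (r k)) +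
          2 * L2_sq (\<lambda>\<zeta>. f (of_real (r k) * \<zeta>) - \<phi> \<zeta>)"
      proof (rule order_trans[OF L2_sq_triangle[OF L2[OF t] L2[OF r] \<phi>(1), of k]], rule add_mono)
        show "2 * L2_sq (\<lambda>\<zeta>. f (of_real t * \<zeta>) - f (of_real (r k) * \<zeta>))
            \<le> 2 * (2 * dilation_defect f t + 2 * dilation_defect f (r k))"
          by (intro mult_left_mono dilate_diff_le f t r) simp
      qed (simp add: L2_sq_minus_commute[of \<phi>])
    qed
  qed simp
  have "((\<lambda>t. L2_sq (\<lambda>\<zeta>. f (of_real t * \<zeta>) - \<phi> \<zeta>)) \<longlongrightarrow> 0) (at_left 1)"
  proof (rule tendsto_sandwich[where f="\<lambda>_. 0", OF always_eventually])
    show "\<forall>\<^sub>F t in at_left 1. L2_sq (\<lambda>\<zeta>. f (of_real t * \<zeta>) - \<phi> \<zeta>) \<le> 4 * dilation_defect f t"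
      using eventually_at_left_1 by eventually_elim (use le in auto)
    show "((\<lambda>t. 4 * dilation_defect f t) \<longlongrightarrow> 0) (at_left 1)"
      using tendsto_mult[OF tendsto_const dilation_defect_tendsto_0[OF f], of 4] by simp
  qed (auto intro: tendsto_const)
  with \<phi>(1) show ?thesis unfolding has_boundary_def L2_sq_def by blast
qed

lemma boundary:
  assumes "f \<in> hardy2"
  shows boundary_L2: "boundary f \<in> L2_circle"
    and boundary_tendsto: "((\<lambda>r. L2_sq (\<lambda>\<zeta>. f (of_real r * \<zeta>) - boundary f \<zeta>)) \<longlongrightarrow> 0) (at_left 1)"
proof -
  have "has_boundary f (boundary f)"
    unfolding boundary_def by (rule someI_ex[OF boundary_exists[OF assms]])
  then show "boundary f \<in> L2_circle" "((\<lambda>r. L2_sq (\<lambda>\<zeta>. f (of_real r * \<zeta>) - boundary f \<zeta>)) \<longlongrightarrow> 0) (at_left 1)"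
    by (simp_all add: has_boundary_def L2_sq_def)
qed

lemma dilate_inner_tendsto:
  assumes f: "f \<in> hardy2" and \<psi>: "\<psi> \<in> L2_circle"
  shows "((\<lambda>r. L2_inner (\<lambda>\<zeta>. f (of_real r * \<zeta>)) \<psi>) \<longlongrightarrow> L2_inner (boundary f) \<psi>) (at_left 1)"
proof (rule L2_inner_tendsto[OF _ boundary_L2[OF f] \<psi> boundary_tendsto[OF f]])
  show "\<forall>\<^sub>F r in at_left 1. (\<lambda>\<zeta>. f (of_real r * \<zeta>)) \<in> L2_circle"
    using eventually_at_left_1 by eventually_elim (use dilate_L2[OF hardy2_holomorphic[OF f]] in auto)
qed

lemma boundary_coefficient:
  assumes f: "f \<in> hardy2"
  shows "L2_inner (boundary f) (\<lambda>\<zeta>. \<zeta> ^ n) = taylor f n"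
proof (rule tendsto_unique[OF _ dilate_inner_tendsto[OF f monomial_L2]])
  have "((\<lambda>r. taylor f n * of_real r ^ n) \<longlongrightarrow> taylor f n * of_real 1 ^ n) (at_left 1)"
    by (intro tendsto_intros)
  then have "((\<lambda>r. taylor f n * of_real r ^ n) \<longlongrightarrow> taylor f n) (at_left 1)" by simp
  then show "((\<lambda>r. L2_inner (\<lambda>\<zeta>. f (of_real r * \<zeta>)) (\<lambda>\<zeta>. \<zeta> ^ n)) \<longlongrightarrow> taylor f n) (at_left 1)"
    by (rule Lim_transform_eventually)
       (use eventually_at_left_1 in eventually_elim, simp add: dilate_coefficient[OF hardy2_holomorphic[OF f]])
qed (simp add: trivial_limit_at_left_real)

text \<open>The identity holds termwise for the dilates of \<open>f\<close>, with an additional factor \<open>r ^ n\<close> (Abel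
  summation). Square-summability of both coefficient sequences dominates the terms as \<open>r\<close> tends to \<open>1\<close>.\<close>

lemma boundary_inner_sums:
  assumes f: "f \<in> hardy2" and \<psi>: "\<psi> \<in> L2_circle"
    and s: "summable (\<lambda>n. (norm (L2_inner \<psi> (\<lambda>\<zeta>. \<zeta> ^ n)))\<^sup>2)"
  shows "(\<lambda>n. taylor f n * cnj (L2_inner \<psi> (\<lambda>\<zeta>. \<zeta> ^ n))) sums L2_inner (boundary f) \<psi>"
proof -
  let ?d = "\<lambda>n. L2_inner \<psi> (\<lambda>\<zeta>. \<zeta> ^ n)"
  have le: "norm (taylor f n) * norm (?d n) \<le> (norm (taylor f n))\<^sup>2 + (norm (?d n))\<^sup>2" for n
  proof -
    have "0 \<le> norm (taylor f n) * norm (?d n)" by simp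
    then show ?thesis using sum_squares_bound[of "norm (taylor f n)" "norm (?d n)"] by linarith
  qed
  have M: "summable (\<lambda>n. (norm (taylor f n))\<^sup>2 + (norm (?d n))\<^sup>2)"
    by (intro summable_add hardy2_summable f s)
  have summ: "summable (\<lambda>n. taylor f n * cnj (?d n))"
    by (rule summable_comparison_test'[OF M]) (use le in \<open>auto simp: norm_mult\<close>)
  have "((\<lambda>r. \<Sum>n. (taylor f n * of_real r ^ n) * cnj (?d n)) \<longlongrightarrow> (\<Sum>n. (taylor f n * of_real 1 ^ n) * cnj (?d n))) (at_left 1)"
  proof (rule tendsto_suminf_at_left_1[OF _ _ M])
    fix k and r :: real assume r: "0 < r" "r < 1"
    have "norm ((taylor f k * of_real r ^ k) * cnj (?d k)) = norm (taylor f k) * norm (?d k) * r ^ k"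
      using r by (simp add: norm_mult norm_power)
    also have "\<dots> \<le> norm (taylor f k) * norm (?d k)"
      using r by (intro mult_left_le power_le_one) auto
    finally show "norm ((taylor f k * of_real r ^ k) * cnj (?d k)) \<le> (norm (taylor f k))\<^sup>2 + (norm (?d k))\<^sup>2"
      using le order_trans by blast
  qed (intro tendsto_intros)
  moreover have "\<forall>\<^sub>F r in at_left 1. (\<Sum>n. (taylor f n * of_real r ^ n) * cnj (?d n)) = L2_inner (\<lambda>\<zeta>. f (of_real r * \<zeta>)) \<psi>"
    using eventually_at_left_1
  proof eventually_elim
    case (elim r)
    then show ?case
      using dilate_inner[OF hardy2_holomorphic[OF f] _ _ \<psi>, of r]
      by (simp add: L2_inner_commute[of _ \<psi>] sums_iff)
  qed
  ultimately have "((\<lambda>r. L2_inner (\<lambda>\<zeta>. f (of_real r * \<zeta>)) \<psi>) \<longlongrightarrow> (\<Sum>n. taylor f n * cnj (?d n))) (at_left 1)"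
    by (simp add: tendsto_cong)
  then have "L2_inner (boundary f) \<psi> = (\<Sum>n. taylor f n * cnj (?d n))"
    using tendsto_unique[OF _ dilate_inner_tendsto[OF f \<psi>]] by (simp add: trivial_limit_at_left_real)
  with summ show ?thesis by (simp add: sums_iff)
qed

lemma hardy_inner_sums:
  assumes "f \<in> hardy2" "g \<in> hardy2"
  shows "(\<lambda>n. taylor f n * cnj (taylor g n)) sums hardy_inner f g"
  unfolding hardy_inner_def
  using boundary_inner_sums[OF assms(1) boundary_L2[OF assms(2)]] assms
  by (simp add: boundary_coefficient hardy2_summable)

section \<open>Hilbert space structure of the Hardy space\<close>

lemma hardy2_add:
  assumes "f \<in> hardy2" "g \<in> hardy2"
  shows "f + g \<in> hardy2" and "taylor (f + g) = (\<lambda>n. taylor f n + taylor g n)"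
proof -
  have s: "(\<lambda>n. (taylor f n + taylor g n) * z ^ n) sums (f + g) z" if "norm z < 1" for z
    using sums_add[OF hardy2_sums[OF assms(1) that] hardy2_sums[OF assms(2) that]]
    by (simp add: distrib_right)
  have "summable (\<lambda>n. (norm (taylor f n + taylor g n))\<^sup>2)"
    by (rule summable_comparison_test'[where g="\<lambda>n. 2 * (norm (taylor f n))\<^sup>2 + 2 * (norm (taylor g n))\<^sup>2"])
       (use norm_add_sq_le in \<open>auto intro!: summable_add summable_mult hardy2_summable assms\<close>)
  from hardy2I[where f="f + g", OF s _ this] show "f + g \<in> hardy2" "taylor (f + g) = (\<lambda>n. taylor f n + taylor g n)"
    using hardy2_outside[OF assms(1)] hardy2_outside[OF assms(2)] by auto
qed

lemma hardy2_scale: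
  assumes "f \<in> hardy2"
  shows "fun_scale c f \<in> hardy2" and "taylor (fun_scale c f) = (\<lambda>n. c * taylor f n)"
proof -
  have s: "(\<lambda>n. (c * taylor f n) * z ^ n) sums fun_scale c f z" if "norm z < 1" for z
    using sums_mult[OF hardy2_sums[OF assms that], of c] by (simp add: fun_scale_def mult.assoc)
  have "summable (\<lambda>n. (norm (c * taylor f n))\<^sup>2)"
    unfolding norm_mult power_mult_distrib by (intro summable_mult hardy2_summable assms)
  from hardy2I[where f="fun_scale c f", OF s _ this] show "fun_scale c f \<in> hardy2" "taylor (fun_scale c f) = (\<lambda>n. c * taylor f n)"
    using hardy2_outside[OF assms] by (auto simp: fun_scale_def)
qed

lemma zero_in_hardy2: "0 \<in> hardy2"
  by (rule hardy2I(1)[where c="\<lambda>_. 0"]) auto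

lemma subspace_hardy2: "cfun.subspace hardy2"
  by (intro cfun.subspaceI hardy2_add hardy2_scale zero_in_hardy2)

lemmas hardy2_diff = cfun.subspace_diff[OF subspace_hardy2]

lemma hardy_inner_add_left:
  assumes "f \<in> hardy2" "g \<in> hardy2" "h \<in> hardy2"
  shows "hardy_inner (f + g) h = hardy_inner f h + hardy_inner g h"
  using sums_add[OF hardy_inner_sums[OF assms(1,3)] hardy_inner_sums[OF assms(2,3)]]
    hardy_inner_sums[OF hardy2_add(1)[OF assms(1,2)] assms(3)]
  by (simp add: hardy2_add(2) assms distrib_right sums_unique2)

lemma hardy_inner_scale_left:
  assumes "f \<in> hardy2" "h \<in> hardy2"
  shows "hardy_inner (fun_scale c f) h = c * hardy_inner f h"
  using sums_mult[OF hardy_inner_sums[OF assms], of c]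
    hardy_inner_sums[OF hardy2_scale(1)[OF assms(1)] assms(2), of c]
  by (simp add: hardy2_scale(2) assms mult.assoc sums_unique2)

lemma hardy_inner_commute: "hardy_inner g f = cnj (hardy_inner f g)"
  unfolding hardy_inner_def by (rule L2_inner_commute)

lemma hardy_inner_diff_left:
  assumes "f \<in> hardy2" "g \<in> hardy2" "h \<in> hardy2"
  shows "hardy_inner (f - g) h = hardy_inner f h - hardy_inner g h"
  using hardy_inner_add_left[OF hardy2_diff[OF assms(1,2)] assms(2,3)] by simp

lemma hardy_inner_add_right:
  assumes "f \<in> hardy2" "g \<in> hardy2" "h \<in> hardy2"
  shows "hardy_inner h (f + g) = hardy_inner h f + hardy_inner h g"
  using hardy_inner_add_left[OF assms] hardy_inner_commute by (metis complex_cnj_add)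

lemma hardy_inner_scale_right:
  assumes "f \<in> hardy2" "h \<in> hardy2"
  shows "hardy_inner h (fun_scale c f) = cnj c * hardy_inner h f"
  using hardy_inner_scale_left[OF assms] hardy_inner_commute by (metis complex_cnj_mult)

lemma hardy_inner_zero_left: "h \<in> hardy2 \<Longrightarrow> hardy_inner 0 h = 0"
  using hardy_inner_diff_left[of h h h] by simp

lemma hardy_inner_zero_right: "h \<in> hardy2 \<Longrightarrow> hardy_inner h 0 = 0"
  using hardy_inner_zero_left[of h] hardy_inner_commute[of h 0] by simp

lemma sum_in_hardy2: "(\<And>i. i \<in> I \<Longrightarrow> f i \<in> hardy2) \<Longrightarrow> (\<Sum>i\<in>I. fun_scale (c i) (f i)) \<in> hardy2"
  by (intro cfun.subspace_sum[OF subspace_hardy2] hardy2_scale)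

lemma hardy_inner_sum_left:
  assumes "finite I" "\<And>i. i \<in> I \<Longrightarrow> f i \<in> hardy2" "h \<in> hardy2"
  shows "hardy_inner (\<Sum>i\<in>I. fun_scale (c i) (f i)) h = (\<Sum>i\<in>I. c i * hardy_inner (f i) h)"
  using assms
proof (induction I rule: finite_induct)
  case (insert i I)
  then show ?case
    by (simp add: hardy_inner_add_left hardy_inner_scale_left hardy2_scale sum_in_hardy2 del: plus_fun_apply)
qed (simp add: hardy_inner_zero_left)

lemma hardy_inner_self_eq_0:
  assumes f: "f \<in> hardy2" and 0: "hardy_inner f f = 0"
  shows "f = 0"
proof -
  have "(\<lambda>n. of_real ((norm (taylor f n))\<^sup>2)) sums hardy_inner f f"
    using hardy_inner_sums[OF f f] by (simp only: complex_norm_square)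
  then have "(\<lambda>n. (norm (taylor f n))\<^sup>2) sums 0"
    unfolding 0 using sums_of_real_iff[of "\<lambda>n. (norm (taylor f n))\<^sup>2" 0, where ?'a = complex] by simp
  then have "taylor f n = 0" for n
    using suminf_eq_zero_iff[of "\<lambda>n. (norm (taylor f n))\<^sup>2"] by (simp add: sums_iff)
  moreover have "taylor 0 = (\<lambda>n. 0)"
    by (rule hardy2I(2)) auto
  ultimately show ?thesis
    by (intro hardy2_eqI f zero_in_hardy2) auto
qed

lemma hardy2_eq_by_inner:
  assumes "f \<in> hardy2" "g \<in> hardy2" "\<And>h. h \<in> hardy2 \<Longrightarrow> hardy_inner f h = hardy_inner g h"
  shows "f = g"
  using hardy_inner_self_eq_0[of "f - g"] hardy2_diff[OF assms(1,2)] assms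
  by (simp add: hardy_inner_diff_left)

lemma hardy_inner_span_eq_0:
  assumes A: "A \<subseteq> hardy2" and f: "f \<in> hardy2" and 0: "\<And>a. a \<in> A \<Longrightarrow> hardy_inner f a = 0"
    and p: "p \<in> cfun.span A"
  shows "hardy_inner f p = 0"
proof -
  have "p \<in> hardy2 \<and> hardy_inner f p = 0"
    using p
  proof (induction rule: cfun.span_induct_alt)
    case base
    then show ?case by (simp add: zero_in_hardy2 hardy_inner_zero_right f del: zero_fun_apply)
  next
    case (step c x y)
    then show ?case
      using A f 0 by (auto simp: hardy2_add hardy2_scale hardy_inner_add_right hardy_inner_scale_right subset_iff simp del: plus_fun_apply)
  qed
  then show ?thesis ..
qed

text \<open>One step of the Gram--Schmidt process: given a vector \<open>a\<close> to be added to \<open>A\<close>, the new direction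
  is \<open>e = a - q\<close> with \<open>q\<close> the projection of \<open>a\<close>, and the projection of \<open>f\<close> has to be corrected by a multiple
  of \<open>e\<close>. For \<open>a\<close> in the span of \<open>A\<close> this correction is \<open>0\<close>.\<close>

lemma finite_orthogonal_projection:
  assumes "finite A" "A \<subseteq> hardy2" "f \<in> hardy2"
  shows "\<exists>p \<in> cfun.span A. \<forall>a\<in>A. hardy_inner (f - p) a = 0"
  using assms
proof (induction A arbitrary: f rule: finite_induct)
  case empty
  then show ?case by (auto intro: cfun.span_zero)
next
  case (insert a A)
  have A: "A \<subseteq> hardy2" and a: "a \<in> hardy2" and f: "f \<in> hardy2" using insert.prems by auto
  have span: "cfun.span A \<subseteq> hardy2" by (rule cfun.span_minimal[OF A subspace_hardy2])
  obtain q where q: "q \<in> cfun.span A" "\<And>b. b \<in> A \<Longrightarrow> hardy_inner (a - q) b = 0"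
    using insert.IH[OF A a] by blast
  obtain p where p: "p \<in> cfun.span A" "\<And>b. b \<in> A \<Longrightarrow> hardy_inner (f - p) b = 0"
    using insert.IH[OF A f] by blast
  define e where "e = a - q"
  define t where "t = hardy_inner (f - p) e / hardy_inner e e"
  have qH: "q \<in> hardy2" and pH: "p \<in> hardy2" using p q span by auto
  have eH: "e \<in> hardy2" unfolding e_def by (rule hardy2_diff[OF a qH])
  have gH: "f - p \<in> hardy2" by (rule hardy2_diff[OF f pH])
  have split: "f - (p + fun_scale t e) = (f - p) - fun_scale t e" by simp
  have eA: "hardy_inner e b = 0" if "b \<in> A" for b using q(2)[OF that] by (simp add: e_def)
  have orthA: "hardy_inner (f - (p + fun_scale t e)) b = 0" if "b \<in> A" for b
    unfolding split using that A p(2) eA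
    by (simp add: hardy_inner_diff_left hardy_inner_scale_left gH eH hardy2_scale subset_iff)
  have rH: "f - (p + fun_scale t e) \<in> hardy2"
    by (intro hardy2_diff hardy2_add hardy2_scale f pH eH)
  have orthe: "hardy_inner (f - (p + fun_scale t e)) e = 0"
  proof (cases "hardy_inner e e = 0")
    case True
    then have "e = 0" by (rule hardy_inner_self_eq_0[OF eH])
    then show ?thesis by (simp only: hardy_inner_zero_right[OF rH[unfolded \<open>e = 0\<close>]])
  next
    case False
    then show ?thesis
      unfolding split
      by (simp add: hardy_inner_diff_left hardy_inner_scale_left gH eH hardy2_scale t_def)
  qed
  have "hardy_inner (f - (p + fun_scale t e)) (e + q) = 0"
    by (simp only: hardy_inner_add_right[OF eH qH rH] orthe hardy_inner_span_eq_0[OF A rH orthA q(1)] add_0_left)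
  then have ortha: "hardy_inner (f - (p + fun_scale t e)) a = 0"
    by (simp add: e_def)
  have "p \<in> cfun.span (insert a A)" "q \<in> cfun.span (insert a A)" "a \<in> cfun.span (insert a A)"
    using p(1) q(1) cfun.span_mono[of A "insert a A"] by (auto intro: cfun.span_base)
  then have mem: "p + fun_scale t e \<in> cfun.span (insert a A)"
    unfolding e_def by (intro cfun.span_add cfun.span_scale cfun.span_diff)
  have "\<forall>b\<in>insert a A. hardy_inner (f - (p + fun_scale t e)) b = 0"
    using orthA ortha by blast
  then show ?case using mem by (rule bexI)
qed

section \<open>The projection onto the Hardy space\<close>

text \<open>Bessel's inequality: subtracting the \<open>N\<close>-th Fourier partial sum \<open>g\<close> from \<open>\<phi>\<close> lowers the squared
  norm by exactly the sum of the first \<open>N\<close> squared coefficients.\<close>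

lemma Bessel_summable:
  assumes \<phi>: "\<phi> \<in> L2_circle"
  shows "summable (\<lambda>n. (norm (L2_inner \<phi> (\<lambda>\<zeta>. \<zeta> ^ n)))\<^sup>2)"
proof -
  let ?c = "\<lambda>n. L2_inner \<phi> (\<lambda>\<zeta>. \<zeta> ^ n)"
  have "(\<Sum>n<N. (norm (?c n))\<^sup>2) \<le> L2_sq \<phi>" for N
  proof -
    define d where "d = (\<lambda>n. if n \<in> {..<N} then ?c n else 0)"
    define g where "g = (\<lambda>\<zeta>. \<Sum>n<N. ?c n * \<zeta> ^ n)"
    have s: "summable (\<lambda>n. norm (d n))" by (rule summable_finite[of "{..<N}"]) (auto simp: d_def)
    have g: "(\<lambda>n. d n * \<zeta> ^ n) sums g \<zeta>" for \<zeta>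
      using sums_If_finite_set[of "{..<N}" "\<lambda>n. ?c n * \<zeta> ^ n"]
      by (simp add: d_def g_def if_distrib[where f="\<lambda>x. x * _"] cong: if_cong)
    have gL2: "g \<in> L2_circle" by (intro L2_continuous Fourier_series_continuous[OF s g])
    have inner: "L2_inner g \<phi> = of_real (\<Sum>n<N. (norm (?c n))\<^sup>2)"
    proof -
      have "(\<lambda>n. if n \<in> {..<N} then ?c n * cnj (?c n) else 0) sums L2_inner g \<phi>"
        using Fourier_series_inner[OF s g \<phi>]
        by (simp add: d_def L2_inner_commute[of _ \<phi>] if_distrib[where f="\<lambda>x. x * _"] cong: if_cong)
      then have "L2_inner g \<phi> = (\<Sum>n<N. ?c n * cnj (?c n))"
        using sums_unique2 sums_If_finite_set[of "{..<N}" "\<lambda>n. ?c n * cnj (?c n)"] by blast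
      then show ?thesis by (simp flip: complex_norm_square)
    qed
    have gsq: "L2_sq g = (\<Sum>n<N. (norm (?c n))\<^sup>2)"
    proof -
      have "(\<lambda>n. if n \<in> {..<N} then (norm (?c n))\<^sup>2 else 0) sums L2_sq g"
        using Fourier_series_Parseval[OF s g]
        by (simp add: d_def if_distrib[where f="\<lambda>x. (norm x)\<^sup>2"] cong: if_cong)
      then show ?thesis
        using sums_unique2 sums_If_finite_set[of "{..<N}" "\<lambda>n. (norm (?c n))\<^sup>2"] by blast
    qed
    have "of_real (L2_sq (\<lambda>\<zeta>. \<phi> \<zeta> - g \<zeta>)) = L2_inner (\<lambda>\<zeta>. \<phi> \<zeta> - g \<zeta>) (\<lambda>\<zeta>. \<phi> \<zeta> - g \<zeta>)"
      by (simp add: L2_inner_self)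
    also have "\<dots> = L2_inner \<phi> \<phi> - L2_inner \<phi> g - L2_inner g \<phi> + L2_inner g g"
      by (simp add: L2_inner_diff_left L2_inner_diff_right \<phi> gL2 L2_diff)
    also have "L2_inner \<phi> g = of_real (L2_sq g)"
      by (simp add: L2_inner_commute[of \<phi>] inner gsq)
    finally have "of_real (L2_sq (\<lambda>\<zeta>. \<phi> \<zeta> - g \<zeta>)) = (of_real (L2_sq \<phi> - L2_sq g) :: complex)"
      by (simp add: inner gsq[symmetric] L2_inner_self)
    then have "L2_sq (\<lambda>\<zeta>. \<phi> \<zeta> - g \<zeta>) = L2_sq \<phi> - L2_sq g"
      by (simp only: of_real_eq_iff)
    then show ?thesis using L2_sq_nonneg[of "\<lambda>\<zeta>. \<phi> \<zeta> - g \<zeta>"] gsq by simp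
  qed
  then show ?thesis
    by (intro bounded_imp_summable[where B="L2_sq \<phi>"])
       (auto simp del: sum.lessThan_Suc simp flip: lessThan_Suc_atMost)
qed

text \<open>The Fourier coefficients of nonnegative index are square summable, so they are the Taylor
  coefficients of a Hardy function \<open>f\<close>. The difference \<open>\<phi> - boundary f\<close> is orthogonal to these monomials,
  hence to all boundary functions. Thus the definite description in the definition of the projection is
  meaningful.\<close>

lemma hardy_proj:
  assumes \<phi>: "\<phi> \<in> L2_circle"
  shows hardy_proj_in_hardy2: "hardy_proj \<phi> \<in> hardy2"
    and hardy_proj_inner: "\<And>h. h \<in> hardy2 \<Longrightarrow> hardy_inner (hardy_proj \<phi>) h = L2_inner \<phi> (boundary h)"
proof -
  have iff: "L2_inner (\<lambda>\<zeta>. \<phi> \<zeta> - boundary f \<zeta>) (boundary h) = 0 \<longleftrightarrow> hardy_inner f h = L2_inner \<phi> (boundary h)"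
    if "f \<in> hardy2" "h \<in> hardy2" for f h
    using that by (auto simp: L2_inner_diff_left \<phi> boundary_L2 hardy_inner_def)
  obtain f where f: "f \<in> hardy2" "taylor f = (\<lambda>n. L2_inner \<phi> (\<lambda>\<zeta>. \<zeta> ^ n))"
    using hardy2_of_coefficients[OF Bessel_summable[OF \<phi>]] by blast
  let ?\<psi> = "\<lambda>\<zeta>. \<phi> \<zeta> - boundary f \<zeta>"
  have \<psi>: "?\<psi> \<in> L2_circle" by (intro L2_diff \<phi> boundary_L2 f)
  have coeff: "L2_inner ?\<psi> (\<lambda>\<zeta>. \<zeta> ^ n) = 0" for n
    by (simp add: L2_inner_diff_left \<phi> boundary_L2 f monomial_L2 boundary_coefficient)
  have orth: "L2_inner ?\<psi> (boundary h) = 0" if h: "h \<in> hardy2" for h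
  proof -
    have "(\<lambda>n. 0) sums L2_inner (boundary h) ?\<psi>"
      using boundary_inner_sums[OF h \<psi>] by (simp add: coeff)
    then have "L2_inner (boundary h) ?\<psi> = 0" using sums_unique2 sums_zero by blast
    then show ?thesis by (subst L2_inner_commute) simp
  qed
  have ex1: "\<exists>!f. f \<in> hardy2 \<and> (\<forall>h\<in>hardy2. L2_inner (\<lambda>\<zeta>. \<phi> \<zeta> - boundary f \<zeta>) (boundary h) = 0)"
  proof (rule ex1I[of _ f])
    fix g assume g: "g \<in> hardy2 \<and> (\<forall>h\<in>hardy2. L2_inner (\<lambda>\<zeta>. \<phi> \<zeta> - boundary g \<zeta>) (boundary h) = 0)"
    then show "g = f"
      using iff[of g] iff[OF f(1)] orth by (intro hardy2_eq_by_inner f) auto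
  qed (use f orth in auto)
  have "hardy_proj \<phi> \<in> hardy2 \<and>
      (\<forall>h\<in>hardy2. L2_inner (\<lambda>\<zeta>. \<phi> \<zeta> - boundary (hardy_proj \<phi>) \<zeta>) (boundary h) = 0)"
    unfolding hardy_proj_def by (rule theI'[OF ex1])
  then show "hardy_proj \<phi> \<in> hardy2"
    and "\<And>h. h \<in> hardy2 \<Longrightarrow> hardy_inner (hardy_proj \<phi>) h = L2_inner \<phi> (boundary h)"
    using iff by auto
qed

section \<open>The shift and its adjoint\<close>

definition shift :: "(complex \<Rightarrow> complex) \<Rightarrow> complex \<Rightarrow> complex" where
  "shift f z = z * f z"

lemma shift_hardy2:
  assumes "f \<in> hardy2"
  shows "shift f \<in> hardy2" and "taylor (shift f) = case_nat 0 (taylor f)"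
proof -
  have s: "(\<lambda>n. case_nat 0 (taylor f) n * z ^ n) sums shift f z" if "norm z < 1" for z
    using sums_mult[OF hardy2_sums[OF assms that], of z]
    by (subst sums_Suc_iff[symmetric, where s="shift f z" and f="\<lambda>n. case_nat 0 (taylor f) n * z ^ n", simplified])
       (simp add: shift_def algebra_simps)
  have "summable (\<lambda>n. (norm (case_nat 0 (taylor f) n))\<^sup>2)"
    by (subst summable_Suc_iff[symmetric]) (simp add: hardy2_summable assms)
  from hardy2I[where f="shift f", OF s _ this] show "shift f \<in> hardy2" "taylor (shift f) = case_nat 0 (taylor f)"
    using hardy2_outside[OF assms] by (auto simp: shift_def)
qed

lemma backward_shift_hardy2:
  assumes "f \<in> hardy2"
  shows "backward_shift f \<in> hardy2" and "taylor (backward_shift f) = (\<lambda>n. taylor f (Suc n))"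
proof -
  have s: "(\<lambda>n. taylor f (Suc n) * z ^ n) sums backward_shift f z" if z: "norm z < 1" for z
  proof (cases "z = 0")
    case True
    then show ?thesis
      using powser_sums_zero[of "\<lambda>n. taylor f (Suc n)"]
      by (simp add: backward_shift_def taylor_def)
  next
    case False
    have "(\<lambda>n. taylor f (Suc n) * z ^ Suc n) sums (f z - f 0)"
      using hardy2_sums[OF assms z] sums_Suc_iff[of "\<lambda>n. taylor f n * z ^ n" "f z - f 0"]
      by (simp add: taylor_def)
    from sums_divide[OF this, of z] show ?thesis
      using False z by (simp add: backward_shift_def)
  qed
  have "summable (\<lambda>n. (norm (taylor f (Suc n)))\<^sup>2)"
    using summable_Suc_iff[of "\<lambda>n. (norm (taylor f n))\<^sup>2"] hardy2_summable[OF assms] by simp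
  from hardy2I[where f="backward_shift f", OF s _ this] show "backward_shift f \<in> hardy2" "taylor (backward_shift f) = (\<lambda>n. taylor f (Suc n))"
    by (auto simp: backward_shift_def)
qed

text \<open>The backward shift drops the first coefficient, the shift inserts a zero in front.\<close>

lemma backward_shift_adjoint:
  assumes "f \<in> hardy2" "g \<in> hardy2"
  shows "hardy_inner (backward_shift f) g = hardy_inner f (shift g)"
proof -
  have "(\<lambda>n. taylor f n * cnj (case_nat 0 (taylor g) n)) sums hardy_inner f (shift g)"
    using hardy_inner_sums[OF assms(1) shift_hardy2(1)[OF assms(2)]] by (simp add: shift_hardy2 assms)
  then have "(\<lambda>n. taylor f (Suc n) * cnj (taylor g n)) sums hardy_inner f (shift g)"
    using sums_Suc_iff[of "\<lambda>n. taylor f n * cnj (case_nat 0 (taylor g) n)" "hardy_inner f (shift g)"] by simp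
  moreover have "(\<lambda>n. taylor f (Suc n) * cnj (taylor g n)) sums hardy_inner (backward_shift f) g"
    using hardy_inner_sums[OF backward_shift_hardy2(1)[OF assms(1)] assms(2)]
    by (simp add: backward_shift_hardy2 assms)
  ultimately show ?thesis by (rule sums_unique2[symmetric])
qed

section \<open>Inner multipliers\<close>

lemma le_by_rational_density:
  fixes g :: "real \<Rightarrow> real"
  assumes cont: "continuous_on {a<..<b} g" and le: "\<And>q. a < of_rat q \<Longrightarrow> of_rat q < b \<Longrightarrow> g (of_rat q) \<le> c"
    and r: "a < r" "r < b"
  shows "g r \<le> c"
proof (rule ccontr)
  assume "\<not> g r \<le> c"
  have "isCont g r"
    using cont r by (simp add: continuous_on_eq_continuous_at)
  then have "\<forall>\<^sub>F x in nhds r. g x > c"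
    using \<open>\<not> g r \<le> c\<close> order_tendstoD(1)[of g "g r" "nhds r" c]
    by (simp add: isCont_def tendsto_nhds_iff)
  then obtain d where d: "d > 0" "\<And>x. dist x r < d \<Longrightarrow> g x > c"
    unfolding eventually_nhds_metric by blast
  obtain q where "r < of_rat q" "of_rat q < min b (r + d)"
    using of_rat_dense[of r "min b (r + d)"] r d by auto
  then show False
    using d(2)[of "of_rat q"] le[of q] r by (auto simp: dist_real_def)
qed

text \<open>Continuity allows the Cauchy criterion to be tested at rational points only, which makes existence
  of the limit a countable condition. The thresholds \<open>1 - 1 / (m + 2)\<close> lie in the open interval.\<close>

lemma left_limit_exists_iff_rational_Cauchy:
  fixes f :: "real \<Rightarrow> complex"
  assumes cont: "continuous_on {0<..<1} f"
  shows "(\<exists>l. (f \<longlongrightarrow> l) (at_left 1)) \<longleftrightarrow>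
    (\<forall>k. \<exists>m. \<forall>p q :: rat. 1 - 1 / (real m + 2) < of_rat p \<and> of_rat p < (1::real) \<and>
       1 - 1 / (real m + 2) < of_rat q \<and> of_rat q < (1::real) \<longrightarrow>
       norm (f (of_rat p) - f (of_rat q)) \<le> 1 / (real k + 1))" (is "?L \<longleftrightarrow> ?R")
proof
  assume ?L
  then obtain l where l: "(f \<longlongrightarrow> l) (at_left 1)" by blast
  show ?R
  proof
    fix k
    have "\<forall>\<^sub>F r in at_left 1. dist (f r) l < 1 / (2 * (real k + 1))"
      by (intro tendstoD l) simp
    then obtain b where b: "b < 1" "\<And>r. b < r \<Longrightarrow> r < 1 \<Longrightarrow> dist (f r) l < 1 / (2 * (real k + 1))"
      using eventually_at_left[of 0 "1::real"] by auto
    obtain m where m: "inverse (real (Suc m)) < 1 - b"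
      using reals_Archimedean[of "1 - b"] b by auto
    have "1 / (real m + 2) \<le> inverse (real (Suc m))" by (simp add: field_simps)
    with m have m': "b < 1 - 1 / (real m + 2)" by linarith
    have "norm (f x - f y) \<le> 1 / (real k + 1)"
      if "1 - 1 / (real m + 2) < x" "x < 1" "1 - 1 / (real m + 2) < y" "y < 1" for x y
    proof -
      have "norm (f x - f y) \<le> dist (f x) l + dist (f y) l"
        using dist_triangle2[of "f x" "f y" l] by (simp add: dist_norm)
      also have "\<dots> \<le> 1 / (2 * (real k + 1)) + 1 / (2 * (real k + 1))"
        using b(2)[of x] b(2)[of y] that m' by (intro add_mono less_imp_le) auto
      also have "\<dots> = 1 / (real k + 1)" by (simp add: field_simps)
      finally show ?thesis .
    qed
    then show "\<exists>m. \<forall>p q :: rat. 1 - 1 / (real m + 2) < of_rat p \<and> of_rat p < (1::real) \<and>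
       1 - 1 / (real m + 2) < of_rat q \<and> of_rat q < (1::real) \<longrightarrow>
       norm (f (of_rat p) - f (of_rat q)) \<le> 1 / (real k + 1)" by blast
  qed
next
  assume R: ?R
  have "cauchy_filter (filtermap f (at_left 1))"
    unfolding cauchy_filter_metric_filtermap
  proof (intro allI impI)
    fix e :: real assume "e > 0"
    then obtain k where k: "inverse (real (Suc k)) < e" using reals_Archimedean by blast
    obtain m where m: "\<And>p q :: rat. 1 - 1 / (real m + 2) < of_rat p \<and> of_rat p < (1::real) \<and>
       1 - 1 / (real m + 2) < of_rat q \<and> of_rat q < (1::real) \<Longrightarrow>
       norm (f (of_rat p) - f (of_rat q)) \<le> 1 / (real k + 1)"
      using R by blast
    define d where "d = 1 - 1 / (real m + 2)"
    have d: "0 < d" "d < 1" by (auto simp: d_def field_simps)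
    have cont': "continuous_on {d<..<1} f"
      by (rule continuous_on_subset[OF cont]) (use d in auto)
    have "norm (f x - f y) \<le> 1 / (real k + 1)" if x: "d < x" "x < 1" and y: "d < y" "y < 1" for x y
    proof (rule le_by_rational_density[of d 1 "\<lambda>x. norm (f x - f y)", OF _ _ x])
      show "norm (f (of_rat p) - f y) \<le> 1 / (real k + 1)" if p: "d < of_rat p" "of_rat p < (1::real)" for p
      proof (rule le_by_rational_density[of d 1 "\<lambda>y. norm (f (of_rat p) - f y)", OF _ _ y])
        show "norm (f (of_rat p) - f (of_rat q)) \<le> 1 / (real k + 1)" if "d < of_rat q" "of_rat q < (1::real)" for q
          using m[of p q] p that by (simp add: d_def)
      qed (intro continuous_intros cont')
    qed (intro continuous_intros cont')
    moreover have "1 / (real k + 1) < e" using k by (simp add: field_simps)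
    ultimately have "\<forall>x y. (d < x \<and> x < 1) \<and> (d < y \<and> y < 1) \<longrightarrow> dist (f x) (f y) < e"
      by (fastforce simp: dist_norm)
    moreover have "\<forall>\<^sub>F x in at_left 1. d < x \<and> x < 1"
      using eventually_at_left_real[OF d(2)] by simp
    ultimately show "\<exists>P. eventually P (at_left 1) \<and> (\<forall>x y. P x \<and> P y \<longrightarrow> dist (f x) (f y) < e)"
      by blast
  qed
  moreover have "complete (UNIV :: complex set)"
    by (meson Cauchy_convergent UNIV_I complete_def convergent_def)
  ultimately obtain l where "filtermap f (at_left 1) \<le> nhds l"
    using complete_uniform[where S="UNIV::complex set"]
    by (force simp: filtermap_bot_iff trivial_limit_at_left_real)
  then show ?L by (auto simp: filterlim_def)
qed

text \<open>Measurability is not automatic, because the limit is a total function and takes a fixed junk value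
  where the limit does not exist. The set \<open>E\<close> of points where it does exist is Borel, by the rational
  Cauchy criterion, and on \<open>E\<close> the limit can be taken along one sequence of radii.\<close>

lemma borel_measurable_radial_limit:
  assumes hol: "\<theta> holomorphic_on ball 0 1"
  shows "radial_limit \<theta> \<in> borel_measurable circle_measure"
proof -
  have cont: "continuous_on (ball 0 1) \<theta>" by (rule holomorphic_on_imp_continuous_on[OF hol])
  define h where "h r \<zeta> = (if 0 < r \<and> r < 1 then \<theta> (of_real r * \<zeta>) else 0)" for r :: real and \<zeta>
  have [measurable]: "h r \<in> borel_measurable circle_measure" for r
  proof (rule borel_measurable_circle)
    show "continuous_on (sphere 0 1) (h r)"
    proof (cases "0 < r \<and> r < 1")
      case True
      have "continuous_on (sphere 0 1) (\<lambda>\<zeta>. \<theta> (of_real r * \<zeta>))"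
        by (rule continuous_on_compose2[OF cont]) (use True in \<open>auto intro!: continuous_intros simp: norm_mult\<close>)
      then show ?thesis using True by (simp add: h_def[abs_def])
    next
      case False
      then have "h r = (\<lambda>_. 0)" by (auto simp: h_def)
      then show ?thesis by simp
    qed
  qed
  define E where "E \<zeta> \<longleftrightarrow> (\<forall>k. \<exists>m. \<forall>p q :: rat. 1 - 1 / (real m + 2) < of_rat p \<and> of_rat p < (1::real) \<and>
       1 - 1 / (real m + 2) < of_rat q \<and> of_rat q < (1::real) \<longrightarrow>
       norm (h (of_rat p) \<zeta> - h (of_rat q) \<zeta>) \<le> 1 / (real k + 1))" for \<zeta>
  have [measurable]: "Measurable.pred circle_measure E"
    unfolding E_def[abs_def] by measurable
  define g where "g \<zeta> = lim (\<lambda>n. h (1 - 1 / (real n + 2)) \<zeta>)" for \<zeta>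
  have [measurable]: "g \<in> borel_measurable circle_measure"
    unfolding g_def[abs_def] by measurable
  have eq: "radial_limit \<theta> \<zeta> = (if E \<zeta> then g \<zeta> else (THE l. False))" if \<zeta>: "norm \<zeta> = 1" for \<zeta>
  proof -
    have ev: "\<forall>\<^sub>F r in at_left 1. h r \<zeta> = \<theta> (of_real r * \<zeta>)"
      using eventually_at_left_1 by eventually_elim (simp add: h_def)
    have "continuous_on {0<..<1} (\<lambda>r. \<theta> (of_real r * \<zeta>))"
      by (rule continuous_on_compose2[OF cont]) (use \<zeta> in \<open>auto intro!: continuous_intros simp: norm_mult\<close>)
    then have "continuous_on {0<..<1} (\<lambda>r. h r \<zeta>)"
      by (rule continuous_on_eq) (auto simp: h_def)
    from left_limit_exists_iff_rational_Cauchy[OF this]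
    have E: "E \<zeta> \<longleftrightarrow> (\<exists>l. ((\<lambda>r. \<theta> (of_real r * \<zeta>)) \<longlongrightarrow> l) (at_left 1))"
      unfolding E_def using tendsto_cong[OF ev] by simp
    show ?thesis
    proof (cases "E \<zeta>")
      case True
      then obtain l where l: "((\<lambda>r. \<theta> (of_real r * \<zeta>)) \<longlongrightarrow> l) (at_left 1)" using E by blast
      then have "radial_limit \<theta> \<zeta> = l"
        unfolding radial_limit_def by (intro tendsto_Lim) (auto simp: trivial_limit_at_left_real)
      moreover have "filterlim (\<lambda>n. 1 - 1 / (real n + 2)) (at_left 1) sequentially" by real_asymp
      then have "(\<lambda>n. h (1 - 1 / (real n + 2)) \<zeta>) \<longlonglongrightarrow> l"
        by (rule filterlim_compose[OF iffD2[OF tendsto_cong[OF ev] l]])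
      then have "g \<zeta> = l" unfolding g_def by (rule limI)
      ultimately show ?thesis using True by simp
    next
      case False
      then show ?thesis using E by (simp add: radial_limit_def Topological_Spaces.Lim_def)
    qed
  qed
  have "(\<lambda>\<zeta>. if E \<zeta> then g \<zeta> else (THE l. False)) \<in> borel_measurable circle_measure" by measurable
  then show ?thesis
    by (rule measurable_cong[THEN iffD2, rotated]) (use eq in \<open>auto simp: space_circle_measure\<close>)
qed

lemma model_space_iff:
  "f \<in> model_space \<theta> \<longleftrightarrow> f \<in> hardy2 \<and> (\<forall>h\<in>hardy2. hardy_inner f (\<theta> * h) = 0)"
  by (auto simp: model_space_def inner_multiples_def)

context
  fixes \<theta> :: "complex \<Rightarrow> complex"
  assumes inner: "inner_function \<theta>"
begin

lemma inner_holomorphic: "\<theta> holomorphic_on ball 0 1"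
  using inner by (simp add: inner_function_def)

lemma inner_bounded: obtains B where "\<And>z. norm z < 1 \<Longrightarrow> norm (\<theta> z) \<le> B"
proof -
  obtain B where "\<forall>z\<in>ball 0 1. norm (\<theta> z) \<le> B"
    using inner by (auto simp: inner_function_def bounded_iff)
  then show thesis by (intro that[of B]) simp
qed

lemma radial_limit_measurable [measurable]: "radial_limit \<theta> \<in> borel_measurable circle_measure"
  by (rule borel_measurable_radial_limit[OF inner_holomorphic])

lemma radial_limit_norm: "AE \<zeta> in circle_measure. norm (radial_limit \<theta> \<zeta>) = 1"
  using inner by (auto simp: inner_function_def)

lemma radial_limit_tendsto:
  "AE \<zeta> in circle_measure. ((\<lambda>r. \<theta> (of_real r * \<zeta>)) \<longlongrightarrow> radial_limit \<theta> \<zeta>) (at_left 1)"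
  using inner by (auto simp: inner_function_def)

lemma radial_limit_mult_L2: "\<phi> \<in> L2_circle \<Longrightarrow> (\<lambda>\<zeta>. radial_limit \<theta> \<zeta> * \<phi> \<zeta>) \<in> L2_circle"
  by (rule L2_mult_bounded(1)[where B=1]) (use radial_limit_norm in auto)

lemma cnj_radial_limit_mult_L2: "\<phi> \<in> L2_circle \<Longrightarrow> (\<lambda>\<zeta>. cnj (radial_limit \<theta> \<zeta>) * \<phi> \<zeta>) \<in> L2_circle"
  by (rule L2_mult_bounded(1)[where B=1]) (use radial_limit_norm in auto)

lemma dilate_measurable:
  assumes r: "0 \<le> r" "r < (1::real)"
  shows "(\<lambda>\<zeta>. \<theta> (of_real r * \<zeta>)) \<in> borel_measurable circle_measure"
  using dilate_L2[OF inner_holomorphic r] by (rule L2_measurable)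

lemma inner_mult_hardy2:
  assumes h: "h \<in> hardy2"
  shows "\<theta> * h \<in> hardy2"
proof -
  obtain B where B: "\<And>z. norm z < 1 \<Longrightarrow> norm (\<theta> z) \<le> B" by (rule inner_bounded) blast
  have "(\<lambda>z. \<theta> z * h z) holomorphic_on ball 0 1"
    by (intro holomorphic_intros inner_holomorphic hardy2_holomorphic[OF h])
  moreover have "bdd_above ((\<lambda>r::real. L2_sq (\<lambda>\<zeta>. \<theta> (of_real r * \<zeta>) * h (of_real r * \<zeta>))) ` {0..<1})"
  proof -
    obtain C where C: "\<forall>r\<in>{0..<1}. L2_sq (\<lambda>\<zeta>. h (of_real r * \<zeta>)) \<le> C"
      using h by (auto simp: hardy2_def bdd_above_def L2_sq_def)
    show ?thesis
    proof (rule bdd_aboveI2)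
      fix r :: real assume r: "r \<in> {0..<1}"
      have "L2_sq (\<lambda>\<zeta>. \<theta> (of_real r * \<zeta>) * h (of_real r * \<zeta>)) \<le> B\<^sup>2 * L2_sq (\<lambda>\<zeta>. h (of_real r * \<zeta>))"
        by (rule L2_mult_bounded(2))
           (use r B in \<open>auto intro!: dilate_measurable AE_I2 dilate_L2 hardy2_holomorphic h
              simp: space_circle_measure norm_mult\<close>)
      also have "\<dots> \<le> B\<^sup>2 * C" using C r by (intro mult_left_mono) auto
      finally show "L2_sq (\<lambda>\<zeta>. \<theta> (of_real r * \<zeta>) * h (of_real r * \<zeta>)) \<le> B\<^sup>2 * C" .
    qed
  qed
  ultimately show ?thesis
    using hardy2_outside[OF h] by (auto simp: hardy2_def times_fun_def L2_sq_def)
qed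

text \<open>Dominated convergence: \<open>\<theta>\<close> is bounded on the disc and its dilates converge almost everywhere.\<close>

lemma dilated_multiplier_tendsto:
  assumes \<phi>: "\<phi> \<in> L2_circle"
  shows "((\<lambda>r. L2_sq (\<lambda>\<zeta>. (\<theta> (of_real r * \<zeta>) - radial_limit \<theta> \<zeta>) * \<phi> \<zeta>)) \<longlongrightarrow> 0) (at_left 1)"
proof (rule tendsto_at_left_sequentially[of 0])
  fix S :: "nat \<Rightarrow> real"
  assume S: "\<And>n. S n < 1" "\<And>n. 0 < S n" "S \<longlonglongrightarrow> 1"
  obtain B where B: "\<And>z. norm z < 1 \<Longrightarrow> norm (\<theta> z) \<le> B" by (rule inner_bounded) blast
  note [measurable] = L2_measurable[OF \<phi>]
  have [measurable]: "(\<lambda>\<zeta>. \<theta> (of_real (S n) * \<zeta>)) \<in> borel_measurable circle_measure" for n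
    using S by (intro dilate_measurable less_imp_le)
  have lim: "filterlim S (at_left 1) sequentially"
    using S by (auto simp: filterlim_at less_imp_neq)
  have "(\<lambda>n. LINT \<zeta>|circle_measure. (norm ((\<theta> (of_real (S n) * \<zeta>) - radial_limit \<theta> \<zeta>) * \<phi> \<zeta>))\<^sup>2)
      \<longlonglongrightarrow> (LINT \<zeta>|circle_measure. 0)"
  proof (rule integral_dominated_convergence[where w="\<lambda>\<zeta>. (B + 1)\<^sup>2 * (norm (\<phi> \<zeta>))\<^sup>2"])
    show "integrable circle_measure (\<lambda>\<zeta>. (B + 1)\<^sup>2 * (norm (\<phi> \<zeta>))\<^sup>2)"
      using L2_integrable[OF \<phi>] by simp
    show "AE \<zeta> in circle_measure.
        (\<lambda>n. (norm ((\<theta> (of_real (S n) * \<zeta>) - radial_limit \<theta> \<zeta>) * \<phi> \<zeta>))\<^sup>2) \<longlonglongrightarrow> 0"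
      using radial_limit_tendsto
    proof eventually_elim
      case (elim \<zeta>)
      have "(\<lambda>n. (norm ((\<theta> (of_real (S n) * \<zeta>) - radial_limit \<theta> \<zeta>) * \<phi> \<zeta>))\<^sup>2)
          \<longlonglongrightarrow> (norm ((radial_limit \<theta> \<zeta> - radial_limit \<theta> \<zeta>) * \<phi> \<zeta>))\<^sup>2"
        by (intro tendsto_intros filterlim_compose[OF elim lim])
      then show ?case by simp
    qed
    show "AE \<zeta> in circle_measure. norm ((norm ((\<theta> (of_real (S n) * \<zeta>) - radial_limit \<theta> \<zeta>) * \<phi> \<zeta>))\<^sup>2)
        \<le> (B + 1)\<^sup>2 * (norm (\<phi> \<zeta>))\<^sup>2" for n
      using radial_limit_norm AE_space
    proof eventually_elim
      case (elim \<zeta>)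
      have "norm (\<theta> (of_real (S n) * \<zeta>)) \<le> B"
        using elim S(1)[of n] S(2)[of n] by (intro B) (simp add: space_circle_measure norm_mult)
      then have "norm (\<theta> (of_real (S n) * \<zeta>) - radial_limit \<theta> \<zeta>) \<le> B + 1"
        using norm_triangle_ineq4[of "\<theta> (of_real (S n) * \<zeta>)" "radial_limit \<theta> \<zeta>"] elim by simp
      then show ?case
        by (auto simp: norm_mult power_mult_distrib intro!: mult_right_mono power_mono)
    qed
  qed measurable
  then show "(\<lambda>n. L2_sq (\<lambda>\<zeta>. (\<theta> (of_real (S n) * \<zeta>) - radial_limit \<theta> \<zeta>) * \<phi> \<zeta>)) \<longlonglongrightarrow> 0"
    by (simp add: L2_sq_def)
qed simp

text \<open>The boundary function of a product with \<open>\<theta>\<close> is the product of the boundary functions. It is stated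
  weakly, against test functions, as that is the only form in which boundary functions enter. The proof
  splits \<open>\<theta>\<^sub>r h\<^sub>r - \<theta>\<^sub>1 h\<^sub>1 = \<theta>\<^sub>r (h\<^sub>r - h\<^sub>1) + (\<theta>\<^sub>r - \<theta>\<^sub>1) h\<^sub>1\<close>, where the index is the radius and \<open>1\<close> stands for the
  boundary.\<close>

lemma boundary_inner_mult:
  assumes h: "h \<in> hardy2" and \<psi>: "\<psi> \<in> L2_circle"
  shows "L2_inner (boundary (\<theta> * h)) \<psi> = L2_inner (\<lambda>\<zeta>. radial_limit \<theta> \<zeta> * boundary h \<zeta>) \<psi>"
proof (rule tendsto_unique[OF _ dilate_inner_tendsto[OF inner_mult_hardy2[OF h] \<psi>]])
  let ?w = "\<lambda>\<zeta>. radial_limit \<theta> \<zeta> * boundary h \<zeta>"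
  obtain B where B: "\<And>z. norm z < 1 \<Longrightarrow> norm (\<theta> z) \<le> B" by (rule inner_bounded) blast
  have w: "?w \<in> L2_circle" by (intro radial_limit_mult_L2 boundary_L2 h)
  have L2: "(\<lambda>\<zeta>. (\<theta> * h) (of_real r * \<zeta>)) \<in> L2_circle" if "0 < r" "r < 1" for r
    using that by (intro dilate_L2 hardy2_holomorphic inner_mult_hardy2 h) auto
  have le: "L2_sq (\<lambda>\<zeta>. (\<theta> * h) (of_real r * \<zeta>) - ?w \<zeta>)
      \<le> 2 * (B\<^sup>2 * L2_sq (\<lambda>\<zeta>. h (of_real r * \<zeta>) - boundary h \<zeta>)) +
        2 * L2_sq (\<lambda>\<zeta>. (\<theta> (of_real r * \<zeta>) - radial_limit \<theta> \<zeta>) * boundary h \<zeta>)" if r: "0 < r" "r < 1" for r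
  proof -
    have d: "(\<lambda>\<zeta>. h (of_real r * \<zeta>) - boundary h \<zeta>) \<in> L2_circle"
      using r by (intro L2_diff dilate_L2 boundary_L2 hardy2_holomorphic h) auto
    have m: "(\<lambda>\<zeta>. \<theta> (of_real r * \<zeta>)) \<in> borel_measurable circle_measure"
      using r by (intro dilate_measurable) auto
    have bd: "AE \<zeta> in circle_measure. norm (\<theta> (of_real r * \<zeta>)) \<le> B"
      using r B by (intro AE_I2) (auto simp: space_circle_measure norm_mult)
    have 1: "(\<lambda>\<zeta>. \<theta> (of_real r * \<zeta>) * (h (of_real r * \<zeta>) - boundary h \<zeta>)) \<in> L2_circle"
      "L2_sq (\<lambda>\<zeta>. \<theta> (of_real r * \<zeta>) * (h (of_real r * \<zeta>) - boundary h \<zeta>))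
        \<le> B\<^sup>2 * L2_sq (\<lambda>\<zeta>. h (of_real r * \<zeta>) - boundary h \<zeta>)"
      by (rule L2_mult_bounded(1)[OF m bd d], rule L2_mult_bounded(2)[OF m bd d])
    have 2: "(\<lambda>\<zeta>. (\<theta> (of_real r * \<zeta>) - radial_limit \<theta> \<zeta>) * boundary h \<zeta>) \<in> L2_circle"
      using L2_diff[OF L2_mult_bounded(1)[OF m bd boundary_L2[OF h]] w] by (simp add: left_diff_distrib)
    have "(\<lambda>\<zeta>. (\<theta> * h) (of_real r * \<zeta>) - ?w \<zeta>) =
        (\<lambda>\<zeta>. \<theta> (of_real r * \<zeta>) * (h (of_real r * \<zeta>) - boundary h \<zeta>) +
             (\<theta> (of_real r * \<zeta>) - radial_limit \<theta> \<zeta>) * boundary h \<zeta>)"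
      by (simp add: algebra_simps)
    then show ?thesis using L2_add(2)[OF 1(1) 2] 1(2) by simp
  qed
  show "((\<lambda>r. L2_inner (\<lambda>\<zeta>. (\<theta> * h) (of_real r * \<zeta>)) \<psi>) \<longlongrightarrow> L2_inner ?w \<psi>) (at_left 1)"
  proof (rule L2_inner_tendsto[OF _ w \<psi>])
    show "\<forall>\<^sub>F r in at_left 1. (\<lambda>\<zeta>. (\<theta> * h) (of_real r * \<zeta>)) \<in> L2_circle"
      using eventually_at_left_1 by eventually_elim (use L2 in blast)
    show "((\<lambda>r. L2_sq (\<lambda>\<zeta>. (\<theta> * h) (of_real r * \<zeta>) - ?w \<zeta>)) \<longlongrightarrow> 0) (at_left 1)"
    proof (rule tendsto_sandwich[where f="\<lambda>_. 0", OF always_eventually])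
      show "\<forall>\<^sub>F r in at_left 1. L2_sq (\<lambda>\<zeta>. (\<theta> * h) (of_real r * \<zeta>) - ?w \<zeta>)
        \<le> 2 * (B\<^sup>2 * L2_sq (\<lambda>\<zeta>. h (of_real r * \<zeta>) - boundary h \<zeta>)) +
          2 * L2_sq (\<lambda>\<zeta>. (\<theta> (of_real r * \<zeta>) - radial_limit \<theta> \<zeta>) * boundary h \<zeta>)"
        using eventually_at_left_1 by eventually_elim (use le in blast)
      have "((\<lambda>r. 2 * (B\<^sup>2 * L2_sq (\<lambda>\<zeta>. h (of_real r * \<zeta>) - boundary h \<zeta>)) +
          2 * L2_sq (\<lambda>\<zeta>. (\<theta> (of_real r * \<zeta>) - radial_limit \<theta> \<zeta>) * boundary h \<zeta>))
          \<longlongrightarrow> 2 * (B\<^sup>2 * 0) + 2 * 0) (at_left 1)"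
        by (intro tendsto_intros boundary_tendsto dilated_multiplier_tendsto boundary_L2 h)
      then show "((\<lambda>r. 2 * (B\<^sup>2 * L2_sq (\<lambda>\<zeta>. h (of_real r * \<zeta>) - boundary h \<zeta>)) +
          2 * L2_sq (\<lambda>\<zeta>. (\<theta> (of_real r * \<zeta>) - radial_limit \<theta> \<zeta>) * boundary h \<zeta>)) \<longlongrightarrow> 0) (at_left 1)"
        by simp
    qed (auto intro: tendsto_const)
  qed
qed (simp add: trivial_limit_at_left_real)

lemma inner_mult_isometry:
  assumes f: "f \<in> hardy2" and g: "g \<in> hardy2"
  shows "hardy_inner (\<theta> * f) (\<theta> * g) = hardy_inner f g"
proof -
  let ?m = "\<lambda>h \<zeta>. radial_limit \<theta> \<zeta> * boundary h \<zeta>"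
  note [measurable] = L2_measurable[OF boundary_L2[OF f]] L2_measurable[OF boundary_L2[OF g]]
  have "hardy_inner (\<theta> * f) (\<theta> * g) = L2_inner (?m f) (boundary (\<theta> * g))"
    unfolding hardy_inner_def by (intro boundary_inner_mult f boundary_L2 inner_mult_hardy2 g)
  also have "\<dots> = cnj (L2_inner (boundary (\<theta> * g)) (?m f))" by (rule L2_inner_commute)
  also have "L2_inner (boundary (\<theta> * g)) (?m f) = L2_inner (?m g) (?m f)"
    by (intro boundary_inner_mult g radial_limit_mult_L2 boundary_L2 f)
  also have "cnj \<dots> = L2_inner (?m f) (?m g)" by (rule L2_inner_commute[symmetric])
  also have "\<dots> = hardy_inner f g"
    unfolding L2_inner_def hardy_inner_def
  proof (rule integral_cong_AE)
    show "AE \<zeta> in circle_measure. ?m f \<zeta> * cnj (?m g \<zeta>) = boundary f \<zeta> * cnj (boundary g \<zeta>)"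
      using radial_limit_norm
    proof eventually_elim
      case (elim \<zeta>)
      have "?m f \<zeta> * cnj (?m g \<zeta>) =
          (radial_limit \<theta> \<zeta> * cnj (radial_limit \<theta> \<zeta>)) * (boundary f \<zeta> * cnj (boundary g \<zeta>))"
        by simp
      then show ?case using elim by (simp only: complex_norm_square[symmetric]) simp
    qed
  qed measurable
  finally show ?thesis .
qed

section \<open>Toeplitz operators with conjugate inner symbol and model spaces\<close>

abbreviation (input) coanalytic_toeplitz :: "(complex \<Rightarrow> complex) \<Rightarrow> complex \<Rightarrow> complex" where
  "coanalytic_toeplitz \<equiv> toeplitz (\<lambda>\<zeta>. cnj (radial_limit \<theta> \<zeta>))"

text \<open>The adjoint relation characterises the operator, since a Hardy function is determined by its inner
  products with Hardy functions. From here on the argument stays inside the Hardy space.\<close>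

lemma coanalytic_toeplitz:
  assumes h: "h \<in> hardy2"
  shows toeplitz_hardy2: "coanalytic_toeplitz h \<in> hardy2"
    and toeplitz_adjoint: "\<And>g. g \<in> hardy2 \<Longrightarrow> hardy_inner (coanalytic_toeplitz h) g = hardy_inner h (\<theta> * g)"
proof -
  have L2: "(\<lambda>\<zeta>. cnj (radial_limit \<theta> \<zeta>) * boundary h \<zeta>) \<in> L2_circle"
    by (intro cnj_radial_limit_mult_L2 boundary_L2 h)
  show "coanalytic_toeplitz h \<in> hardy2"
    unfolding toeplitz_def by (rule hardy_proj_in_hardy2[OF L2])
  show "hardy_inner (coanalytic_toeplitz h) g = hardy_inner h (\<theta> * g)" if g: "g \<in> hardy2" for g
  proof -
    have "hardy_inner (coanalytic_toeplitz h) g = L2_inner (\<lambda>\<zeta>. cnj (radial_limit \<theta> \<zeta>) * boundary h \<zeta>) (boundary g)"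
      unfolding toeplitz_def by (rule hardy_proj_inner[OF L2 g])
    also have "\<dots> = L2_inner (boundary h) (\<lambda>\<zeta>. radial_limit \<theta> \<zeta> * boundary g \<zeta>)"
      by (simp add: L2_inner_def mult_ac)
    also have "\<dots> = cnj (L2_inner (\<lambda>\<zeta>. radial_limit \<theta> \<zeta> * boundary g \<zeta>) (boundary h))"
      by (rule L2_inner_commute)
    also have "\<dots> = cnj (L2_inner (boundary (\<theta> * g)) (boundary h))"
      by (subst boundary_inner_mult) (use g h boundary_L2 in auto)
    also have "\<dots> = hardy_inner h (\<theta> * g)"
      unfolding hardy_inner_def by (rule L2_inner_commute[symmetric])
    finally show ?thesis .
  qed
qed

lemma subspace_model_space: "cfun.subspace (model_space \<theta>)"
proof (rule cfun.subspaceI)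
  show "0 \<in> model_space \<theta>"
    unfolding model_space_iff using zero_in_hardy2 hardy_inner_zero_left inner_mult_hardy2 by blast
next
  fix f g assume "f \<in> model_space \<theta>" "g \<in> model_space \<theta>"
  then show "f + g \<in> model_space \<theta>"
    unfolding model_space_iff by (simp add: hardy2_add hardy_inner_add_left inner_mult_hardy2 del: plus_fun_apply)
next
  fix c f assume "f \<in> model_space \<theta>"
  then show "fun_scale c f \<in> model_space \<theta>"
    unfolding model_space_iff by (simp add: hardy2_scale hardy_inner_scale_left inner_mult_hardy2)
qed

text \<open>Multiplication by \<open>\<theta>\<close> is an isometry, and its adjoint is the Toeplitz operator \<open>T\<close> whose symbol is the
  conjugate of \<open>\<theta>\<close>. So \<open>f \<mapsto> \<theta> * T f\<close> is the projection onto the multiples of \<open>\<theta>\<close>, and \<open>f \<mapsto> f - \<theta> * T f\<close> the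
  projection onto their orthogonal complement, the model space.\<close>

lemma model_proj:
  assumes f: "f \<in> hardy2"
  shows model_proj_eq: "model_proj \<theta> f = f - \<theta> * coanalytic_toeplitz f"
    and model_proj_in_model_space: "model_proj \<theta> f \<in> model_space \<theta>"
proof -
  let ?T = "coanalytic_toeplitz f"
  let ?g = "f - \<theta> * ?T"
  have T: "?T \<in> hardy2" and \<theta>T: "\<theta> * ?T \<in> hardy2"
    by (intro inner_mult_hardy2 toeplitz_hardy2 f)+
  have gH: "?g \<in> hardy2" by (rule hardy2_diff[OF f \<theta>T])
  have gK: "?g \<in> model_space \<theta>"
    unfolding model_space_iff
  proof (intro conjI gH ballI)
    fix h assume h: "h \<in> hardy2"
    show "hardy_inner ?g (\<theta> * h) = 0"
      unfolding hardy_inner_diff_left[OF f \<theta>T inner_mult_hardy2[OF h]]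
        inner_mult_isometry[OF T h] toeplitz_adjoint[OF f h] by simp
  qed
  have orth: "hardy_inner (f - ?g) k = 0" if k: "k \<in> model_space \<theta>" for k
  proof -
    have "f - ?g = \<theta> * ?T" by simp
    moreover have "hardy_inner k (\<theta> * ?T) = 0" using k T by (simp add: model_space_iff)
    ultimately show ?thesis using hardy_inner_commute[of "\<theta> * ?T" k] by simp
  qed
  show eq: "model_proj \<theta> f = ?g"
    unfolding model_proj_def
  proof (rule the_equality)
    show "?g \<in> model_space \<theta> \<and> (\<forall>k\<in>model_space \<theta>. hardy_inner (f - ?g) k = 0)"
      using gK orth by blast
    fix g assume g: "g \<in> model_space \<theta> \<and> (\<forall>k\<in>model_space \<theta>. hardy_inner (f - g) k = 0)"
    then have g': "g \<in> hardy2" by (simp add: model_space_iff)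
    have dH: "g - ?g \<in> hardy2" by (rule hardy2_diff[OF g' gH])
    have "g - ?g \<in> model_space \<theta>"
      using g gK cfun.subspace_diff[OF subspace_model_space] by blast
    then have "hardy_inner (f - ?g) (g - ?g) = 0" "hardy_inner (f - g) (g - ?g) = 0"
      using g orth by blast+
    then have "hardy_inner ((f - ?g) - (f - g)) (g - ?g) = 0"
      using hardy_inner_diff_left[OF hardy2_diff[OF f gH] hardy2_diff[OF f g'] dH] by simp
    moreover have "(f - ?g) - (f - g) = g - ?g" by simp
    ultimately have "hardy_inner (g - ?g) (g - ?g) = 0" by (simp only:)
    then have "g - ?g = 0" by (rule hardy_inner_self_eq_0[OF dH])
    then show "g = ?g" by (rule eq_iff_diff_eq_0[THEN iffD2])
  qed
  show "model_proj \<theta> f \<in> model_space \<theta>" using gK eq by (simp only:)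
qed

lemma model_proj_hardy2: "f \<in> hardy2 \<Longrightarrow> model_proj \<theta> f \<in> hardy2"
  using model_proj_in_model_space by (simp add: model_space_iff)

lemma model_proj_inner:
  assumes k: "k \<in> model_space \<theta>" and f: "f \<in> hardy2"
  shows "hardy_inner k (model_proj \<theta> f) = hardy_inner k f"
proof -
  let ?T = "coanalytic_toeplitz f"
  have T: "?T \<in> hardy2" by (rule toeplitz_hardy2[OF f])
  have kH: "k \<in> hardy2" and 0: "hardy_inner k (\<theta> * ?T) = 0"
    using k T by (simp_all add: model_space_iff)
  have "hardy_inner k (model_proj \<theta> f + \<theta> * ?T) = hardy_inner k (model_proj \<theta> f)"
    by (subst hardy_inner_add_right) (use T f kH 0 inner_mult_hardy2 model_proj_hardy2 in auto)
  moreover have "model_proj \<theta> f + \<theta> * ?T = f" using model_proj_eq[OF f] by simp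
  ultimately show ?thesis by simp
qed

end

section \<open>Near invariance of the kernel\<close>

theorem theorem2p7:
  fixes n :: nat
    and u v :: "nat \<Rightarrow> complex \<Rightarrow> complex"
    and \<theta> :: "complex \<Rightarrow> complex"
    and R :: "(complex \<Rightarrow> complex) \<Rightarrow> complex \<Rightarrow> complex"
    and \<Lambda> :: "nat set"
  assumes n: "n \<ge> 1"
    and u_mem: "\<And>i. i \<in> {1..n} \<Longrightarrow> u i \<in> hardy2"
    and u_orthonormal: "\<And>i j. i \<in> {1..n} \<Longrightarrow> j \<in> {1..n} \<Longrightarrow>
          hardy_inner (u i) (u j) = (if i = j then 1 else 0)"
    and v_mem: "\<And>i. i \<in> {1..n} \<Longrightarrow> v i \<in> hardy2"
    and v_nonzero: "\<And>i. i \<in> {1..n} \<Longrightarrow> v i \<noteq> 0"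
    and v_orthogonal: "\<And>i j. i \<in> {1..n} \<Longrightarrow> j \<in> {1..n} \<Longrightarrow> i \<noteq> j \<Longrightarrow>
          hardy_inner (v i) (v j) = 0"
    and \<theta>: "inner_function \<theta>"
    and R: "\<And>h. h \<in> hardy2 \<Longrightarrow>
          R h = toeplitz (\<lambda>\<zeta>. cnj (radial_limit \<theta> \<zeta>)) h
                + (\<Sum>i=1..n. fun_scale (hardy_inner h (u i)) (v i))"
    and \<Lambda>: "\<Lambda> = {k \<in> {1..n}. u k \<notin> inner_multiples \<theta>}"
  shows "nearly_invariant {h \<in> hardy2. R h = 0} (n + card \<Lambda>)
           (cfun.span ({\<theta> * backward_shift (v i) | i. i \<in> {1..n}} \<union>
                       {model_proj \<theta> (u k) | k. k \<in> \<Lambda>}))"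
proof -
  let ?T = "toeplitz (\<lambda>\<zeta>. cnj (radial_limit \<theta> \<zeta>))"
  let ?M = "{h \<in> hardy2. R h = 0}"
  let ?V = "{\<theta> * backward_shift (v i) | i. i \<in> {1..n}}" and ?U = "{model_proj \<theta> (u k) | k. k \<in> \<Lambda>}"
  have \<Lambda>_sub: "\<Lambda> \<subseteq> {1..n}" using \<Lambda> by auto
  have Sv: "backward_shift (v i) \<in> hardy2" if "i \<in> {1..n}" for i
    by (rule backward_shift_hardy2(1)[OF v_mem[OF that]])
  have w: "\<theta> * backward_shift (v i) \<in> hardy2" if "i \<in> {1..n}" for i
    by (rule inner_mult_hardy2[OF \<theta> Sv[OF that]])

  have R_mem: "R h \<in> hardy2" if h: "h \<in> hardy2" for h
    unfolding R[OF h] by (intro hardy2_add toeplitz_hardy2 \<theta> h sum_in_hardy2 v_mem)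
  have R_inner: "hardy_inner (R h) g = hardy_inner h (\<theta> * g) + (\<Sum>i=1..n. hardy_inner h (u i) * hardy_inner (v i) g)"
    if h: "h \<in> hardy2" and g: "g \<in> hardy2" for h g
  proof -
    have "hardy_inner (R h) g = hardy_inner (?T h) g
        + hardy_inner (\<Sum>i=1..n. fun_scale (hardy_inner h (u i)) (v i)) g"
      unfolding R[OF h] by (intro hardy_inner_add_left toeplitz_hardy2 \<theta> h sum_in_hardy2 v_mem g)
    also have "hardy_inner (?T h) g = hardy_inner h (\<theta> * g)" by (rule toeplitz_adjoint[OF \<theta> h g])
    also have "hardy_inner (\<Sum>i=1..n. fun_scale (hardy_inner h (u i)) (v i)) g
        = (\<Sum>i=1..n. hardy_inner h (u i) * hardy_inner (v i) g)"
      by (intro hardy_inner_sum_left v_mem g) auto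
    finally show ?thesis .
  qed
  \<comment> \<open>Tested against \<open>g\<close>, the kernel equation is linear in \<open>h\<close> and free of Toeplitz operators.\<close>
  have ker_iff: "R h = 0 \<longleftrightarrow>
      (\<forall>g\<in>hardy2. hardy_inner h (\<theta> * g) + (\<Sum>i=1..n. hardy_inner h (u i) * hardy_inner (v i) g) = 0)"
    if h: "h \<in> hardy2" for h
  proof
    assume "R h = 0"
    then show "\<forall>g\<in>hardy2. hardy_inner h (\<theta> * g) + (\<Sum>i=1..n. hardy_inner h (u i) * hardy_inner (v i) g) = 0"
      using R_inner[OF h] hardy_inner_zero_left by simp
  next
    assume "\<forall>g\<in>hardy2. hardy_inner h (\<theta> * g) + (\<Sum>i=1..n. hardy_inner h (u i) * hardy_inner (v i) g) = 0"
    then show "R h = 0"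
      using R_inner[OF h] by (intro hardy2_eq_by_inner R_mem h zero_in_hardy2) (simp add: hardy_inner_zero_left)
  qed

  have subspace_M: "cfun.subspace ?M"
  proof (rule cfun.subspaceI)
    show "0 \<in> ?M"
      using zero_in_hardy2 by (simp add: ker_iff hardy_inner_zero_left inner_mult_hardy2[OF \<theta>] u_mem)
  next
    fix f g assume "f \<in> ?M" "g \<in> ?M"
    then have f: "f \<in> hardy2" "R f = 0" and g: "g \<in> hardy2" "R g = 0" by auto
    have "R (f + g) = 0"
      unfolding ker_iff[OF hardy2_add(1)[OF f(1) g(1)]]
    proof
      fix k assume k: "k \<in> hardy2"
      have "hardy_inner (f + g) (\<theta> * k) + (\<Sum>i=1..n. hardy_inner (f + g) (u i) * hardy_inner (v i) k)
          = (hardy_inner f (\<theta> * k) + (\<Sum>i=1..n. hardy_inner f (u i) * hardy_inner (v i) k))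
          + (hardy_inner g (\<theta> * k) + (\<Sum>i=1..n. hardy_inner g (u i) * hardy_inner (v i) k))"
        by (simp add: hardy_inner_add_left f g inner_mult_hardy2[OF \<theta> k] u_mem distrib_right sum.distrib
            del: plus_fun_apply)
      also have "\<dots> = 0" using f g k ker_iff by simp
      finally show "hardy_inner (f + g) (\<theta> * k) + (\<Sum>i=1..n. hardy_inner (f + g) (u i) * hardy_inner (v i) k) = 0" .
    qed
    then show "f + g \<in> ?M" using hardy2_add(1)[OF f(1) g(1)] by simp
  next
    fix c f assume "f \<in> ?M"
    then have f: "f \<in> hardy2" "R f = 0" by auto
    have "R (fun_scale c f) = 0"
      unfolding ker_iff[OF hardy2_scale(1)[OF f(1)]]
    proof
      fix k assume k: "k \<in> hardy2"
      have "hardy_inner (fun_scale c f) (\<theta> * k) + (\<Sum>i=1..n. hardy_inner (fun_scale c f) (u i) * hardy_inner (v i) k)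
          = c * (hardy_inner f (\<theta> * k) + (\<Sum>i=1..n. hardy_inner f (u i) * hardy_inner (v i) k))"
        by (simp add: hardy_inner_scale_left f inner_mult_hardy2[OF \<theta> k] u_mem distrib_left sum_distrib_left mult.assoc)
      also have "\<dots> = 0" using f k ker_iff by simp
      finally show "hardy_inner (fun_scale c f) (\<theta> * k) +
          (\<Sum>i=1..n. hardy_inner (fun_scale c f) (u i) * hardy_inner (v i) k) = 0" .
    qed
    then show "fun_scale c f \<in> ?M" using hardy2_scale(1)[OF f(1)] by simp
  qed

  have V_image: "?V = (\<lambda>i. \<theta> * backward_shift (v i)) ` {1..n}" by auto
  have U_image: "?U = (\<lambda>k. model_proj \<theta> (u k)) ` \<Lambda>" by auto
  have fin_\<Lambda>: "finite \<Lambda>" using \<Lambda>_sub finite_subset by blast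
  have fin: "finite (?V \<union> ?U)" unfolding V_image U_image using fin_\<Lambda> by simp
  have card: "card (?V \<union> ?U) \<le> n + card \<Lambda>"
  proof -
    have "card (?V \<union> ?U) \<le> card ?V + card ?U" by (rule card_Un_le)
    also have "card ?V \<le> n" unfolding V_image using card_image_le[of "{1..n}"] by simp
    also have "card ?U \<le> card \<Lambda>" unfolding U_image by (rule card_image_le[OF fin_\<Lambda>])
    finally show ?thesis by simp
  qed
  have U_hardy2: "?U \<subseteq> hardy2"
    using \<Lambda>_sub by (auto intro!: model_proj_hardy2 \<theta> u_mem)
  have sub: "?V \<union> ?U \<subseteq> hardy2" using U_hardy2 w by blast
  have F_hardy2: "cfun.span (?V \<union> ?U) \<subseteq> hardy2" by (rule cfun.span_minimal[OF sub subspace_hardy2])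

  have decomposition: "\<exists>g\<in>?M. \<exists>p\<in>cfun.span (?V \<union> ?U). backward_shift h = g + p" if "h \<in> ?M" for h
  proof -
    have h: "h \<in> hardy2" and Rh: "R h = 0" using that by auto
    \<comment> \<open>As \<open>T (\<theta> S\<^sup>* v\<^sub>i) = S\<^sup>* v\<^sub>i\<close>, adding \<open>q\<close> to \<open>S\<^sup>* h\<close> turns \<open>S\<^sup>* (R h) = 0\<close> into \<open>T f = 0\<close>.\<close>
    define q where "q = (\<Sum>i=1..n. fun_scale (hardy_inner h (u i)) (\<theta> * backward_shift (v i)))"
    define f where "f = backward_shift h + q"
    have Sh: "backward_shift h \<in> hardy2" by (rule backward_shift_hardy2(1)[OF h])
    have qH: "q \<in> hardy2" unfolding q_def by (intro sum_in_hardy2 w)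
    have fH: "f \<in> hardy2" unfolding f_def by (rule hardy2_add(1)[OF Sh qH])
    have fK: "f \<in> model_space \<theta>"
      unfolding model_space_iff
    proof (intro conjI fH ballI)
      fix g assume g: "g \<in> hardy2"
      have sg: "shift g \<in> hardy2" and \<theta>g: "\<theta> * g \<in> hardy2"
        by (rule shift_hardy2(1)[OF g], rule inner_mult_hardy2[OF \<theta> g])
      have comm: "shift (\<theta> * g) = \<theta> * shift g" by (auto simp: shift_def)
      have "hardy_inner f (\<theta> * g) = hardy_inner (backward_shift h) (\<theta> * g) + hardy_inner q (\<theta> * g)"
        unfolding f_def by (rule hardy_inner_add_left[OF Sh qH \<theta>g])
      also have "hardy_inner (backward_shift h) (\<theta> * g) = hardy_inner h (\<theta> * shift g)"
        unfolding comm[symmetric] by (rule backward_shift_adjoint[OF h \<theta>g])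
      also have "hardy_inner q (\<theta> * g) = (\<Sum>i=1..n. hardy_inner h (u i) * hardy_inner (\<theta> * backward_shift (v i)) (\<theta> * g))"
        unfolding q_def by (intro hardy_inner_sum_left w \<theta>g) auto
      also have "\<dots> = (\<Sum>i=1..n. hardy_inner h (u i) * hardy_inner (v i) (shift g))"
        by (intro sum.cong refl) (simp only: inner_mult_isometry[OF \<theta> Sv g] backward_shift_adjoint[OF v_mem g])
      also have "hardy_inner h (\<theta> * shift g) + \<dots> = 0" using ker_iff[OF h] Rh sg by blast
      finally show "hardy_inner f (\<theta> * g) = 0" .
    qed
    \<comment> \<open>Removing from \<open>f\<close> its projection \<open>p\<close> makes all inner products with the \<open>u\<^sub>k\<close> vanish.\<close>
    obtain p where p: "p \<in> cfun.span ?U" "\<And>k. k \<in> \<Lambda> \<Longrightarrow> hardy_inner (f - p) (model_proj \<theta> (u k)) = 0"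
      using finite_orthogonal_projection[OF _ U_hardy2 fH] fin by blast
    have UK: "?U \<subseteq> model_space \<theta>"
      using \<Lambda>_sub by (auto intro!: model_proj_in_model_space \<theta> u_mem)
    have pK: "p \<in> model_space \<theta>"
      using cfun.span_minimal[OF UK subspace_model_space[OF \<theta>]] p(1) by blast
    have gK: "f - p \<in> model_space \<theta>"
      by (rule cfun.subspace_diff[OF subspace_model_space[OF \<theta>] fK pK])
    then have gH: "f - p \<in> hardy2" by (simp only: model_space_iff)
    have gu: "hardy_inner (f - p) (u k) = 0" if k: "k \<in> {1..n}" for k
    proof (cases "k \<in> \<Lambda>")
      case True
      then show ?thesis using p(2)[OF True] model_proj_inner[OF \<theta> gK u_mem[OF k]] by (simp only:)
    next
      case False
      then obtain g where "g \<in> hardy2" "u k = \<theta> * g"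
        using k \<Lambda> by (auto simp: inner_multiples_def)
      then show ?thesis using gK by (simp only: model_space_iff)
    qed
    have "R (f - p) = 0"
      unfolding ker_iff[OF gH] using gK by (simp add: gu model_space_iff)
    then have gM: "f - p \<in> ?M" using gH by simp
    have "q \<in> cfun.span (?V \<union> ?U)"
      unfolding q_def by (intro cfun.span_sum cfun.span_scale cfun.span_base) auto
    moreover have "p \<in> cfun.span (?V \<union> ?U)" using p(1) cfun.span_mono[of ?U "?V \<union> ?U"] by blast
    ultimately have "p - q \<in> cfun.span (?V \<union> ?U)" by (rule cfun.span_diff[rotated])
    moreover have "backward_shift h = (f - p) + (p - q)" by (simp add: f_def)
    ultimately show ?thesis using gM by blast
  qed

  show ?thesis
    unfolding nearly_invariant_def
  proof (intro conjI ballI impI)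
    show "?M \<subseteq> hardy2" by blast
    show "\<exists>B. finite B \<and> cfun.span (?V \<union> ?U) = cfun.span B" using fin by blast
    show "cfun.dim (cfun.span (?V \<union> ?U)) \<le> n + card \<Lambda>"
      using cfun.dim_le_card[OF order_refl fin] card by (rule order_trans)
  qed (use subspace_M F_hardy2 decomposition in \<open>simp_all only: cfun.subspace_span\<close>)
qed

end
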